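(* Let $\Gamma(\tau)$ and $\sigma(\mathbf{x},\tau)$ be four times differentiable. Let $\mathbf{x}=\mathbf{x}_0+c\sqrt{\Delta t}\,\mathbf{n}$ with $c\in\mathbb{R}$, where $\mathbf{x}_0\in\Gamma(\Delta t)$ is a point on the boundary at time $\Delta t$, $\mathbf{n}$ is the unit inward normal vector to $\Gamma(\Delta t)$ at $\mathbf{x}_0$, $\kappa$ is the curvature and $v$ is the normal velocity of the boundary at $\mathbf{x}_0$ at time $\Delta t$. Then the single layer heat potential $$S[\sigma](\mathbf{x},\Delta t)=\int_0^{\Delta t}\int_{\Gamma(\tau)}G(\mathbf{x}-\mathbf{y},\Delta t-\tau)\,\sigma(\mathbf{y},\tau)\,ds_{\mathbf{y}}\,d\tau$$ satisfies, as $\Delta t\to 0^+$ with $c$ fixed, $$S[\sigma](\mathbf{x},\Delta t)=\frac12\sqrt{\frac{\Delta t}{\pi}}\,E_{3/2}\!\left(\frac{c^2}{4}\right)\left(1+\frac{\kappa-v}{2}\,c\sqrt{\Delta t}\right)\sigma(\mathbf{x}_0,\Delta t)+O(\Delta t^{3/2}).$$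
   Context: The spatial dimension is 2 and $G(\mathbf{x},t)=\frac{1}{4\pi t}e^{-\|\mathbf{x}\|^2/(4t)}$ is the heat kernel. For each time $\tau$, $\Omega(\tau)\subset\mathbb{R}^2$ is a bounded domain with smooth boundary $\Gamma(\tau)$, and $\sigma(\mathbf{y},\tau)$ is a density defined for $\mathbf{y}\in\Gamma(\tau)$. The exponential integral of order $3/2$ is $E_{3/2}(x)=\int_1^\infty t^{-3/2}e^{-xt}\,dt$. Target points are written $\mathbf{x}=\mathbf{x}_0+r\,\mathbf{n}$, where $\mathbf{x}_0$ is the point of $\Gamma(\Delta t)$ closest to $\mathbf{x}$ and $r=c\sqrt{\Delta t}$ is the signed distance to the boundary (positive if $\mathbf{x}$ is in the interior $\Omega(\Delta t)$, negative if exterior). Local coordinates: after a Euclidean motion, $\mathbf{x}_0$ is the origin and $\mathbf{n}$ points in the direction of the positive $y$-axis. In these coordinates, for times $\tau\le\Delta t$, the boundary near the origin is the graph $\{(s,y(s,\tau))\}$ of a function with $y(0,\Delta t)=y_s(0,\Delta t)=0$. The curvature and normal velocity are $\kappa=y_{ss}(0,\Delta t)$ and $v=y_\tau(0,\Delta t)$ (so $v$ is the velocity in the direction of $\mathbf{n}$). The density in these coordinates is written $\sigma(s,\tau)$. "Four times differentiable" refers to $y(s,\tau)$ and $\sigma(s,\tau)$ as functions of $(s,\tau)$. Standing convention: the boundary is such a graph for $|s|<L$, with $L>0$ independent of $\Delta t$, and the remaining part of the boundary stays away from $\mathbf{x}_0$, so that its contribution is exponentially small; equivalently, up to this error, the boundary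 may be regarded as a graph over the whole line. The constant in the $O(\cdot)$ may depend on $c$, on the geometry, and on bounds for the derivatives up to order four of $y$ and $\sigma$, but not on $\Delta t$. *)

theory Defs
  imports "HOL-Analysis.Analysis" "HOL-Library.Landau_Symbols"
begin

definition heat_kernel :: "real^2 \<Rightarrow> real \<Rightarrow> real" where
  "heat_kernel x t = 1 / (4 * pi * t) * exp (- (norm x)\<^sup>2 / (4 * t))"

definition exp_integral :: "real \<Rightarrow> real \<Rightarrow> real" where
  "exp_integral \<nu> x = integral {1..} (\<lambda>t. t powr (- \<nu>) * exp (- x * t))"

text \<open>
  The boundary of a bounded smooth planar domain consists of finitely many disjoint closed curves.
  It is given by parametrizations \<open>\<gamma> i \<tau> : [0,1] \<rightarrow> \<real>\<^sup>2\<close>, \<open>i < m\<close>, of the boundary curves at time \<open>\<tau>\<close>.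
  Equality of the one-sided derivatives at 0 and 1 says that each curve closes up smoothly.
\<close>

definition param_deriv :: "(real \<Rightarrow> real^2) \<Rightarrow> real \<Rightarrow> real^2" where
  "param_deriv g p = vector_derivative g (at p within {0..1})"

definition regular_closed_curve :: "(real \<Rightarrow> real^2) \<Rightarrow> bool" where
  "regular_closed_curve g \<longleftrightarrow>
     simple_path g \<and> pathfinish g = pathstart g \<and>
     (\<forall>p\<in>{0..1}. g differentiable (at p within {0..1}) \<and> param_deriv g p \<noteq> 0) \<and>
     param_deriv g 0 = param_deriv g 1"

definition moving_boundary :: "nat \<Rightarrow> (nat \<Rightarrow> real \<Rightarrow> real \<Rightarrow> real^2) \<Rightarrow> real \<Rightarrow> (real^2) set" where
  "moving_boundary m \<gamma> \<tau> = (\<Union>i<m. path_image (\<gamma> i \<tau>))"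

text \<open>
  The joint continuity in \<open>(p, \<tau>)\<close> expresses that the boundary as a whole moves continuously
  in the \<open>C\<^sup>1\<close> sense.
\<close>

definition moving_domain ::
  "real \<Rightarrow> (real \<Rightarrow> (real^2) set) \<Rightarrow> nat \<Rightarrow> (nat \<Rightarrow> real \<Rightarrow> real \<Rightarrow> real^2) \<Rightarrow> bool" where
  "moving_domain T \<Omega> m \<gamma> \<longleftrightarrow>
     (\<forall>\<tau>\<in>{0..T}.
        open (\<Omega> \<tau>) \<and> connected (\<Omega> \<tau>) \<and> bounded (\<Omega> \<tau>) \<and> \<Omega> \<tau> \<noteq> {} \<and>
        frontier (\<Omega> \<tau>) = moving_boundary m \<gamma> \<tau> \<and>
        (\<forall>i<m. regular_closed_curve (\<gamma> i \<tau>)) \<and>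
        disjoint_family_on (\<lambda>i. path_image (\<gamma> i \<tau>)) {..<m}) \<and>
     (\<forall>i<m. continuous_on ({0..1} \<times> {0..T}) (\<lambda>(p, \<tau>). \<gamma> i \<tau> p) \<and>
            continuous_on ({0..1} \<times> {0..T}) (\<lambda>(p, \<tau>). param_deriv (\<gamma> i \<tau>) p))"

definition arc_length_integral ::
  "nat \<Rightarrow> (nat \<Rightarrow> real \<Rightarrow> real^2) \<Rightarrow> (real^2 \<Rightarrow> real) \<Rightarrow> real" where
  "arc_length_integral m g f =
     (\<Sum>i<m. integral {0..1} (\<lambda>p. f (g i p) * norm (param_deriv (g i) p)))"

definition single_layer ::
  "nat \<Rightarrow> (nat \<Rightarrow> real \<Rightarrow> real \<Rightarrow> real^2) \<Rightarrow> (real^2 \<Rightarrow> real \<Rightarrow> real) \<Rightarrow> real^2 \<Rightarrow> real \<Rightarrow> real" where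
  "single_layer m \<gamma> \<sigma> x t =
     integral {0..t} (\<lambda>\<tau>. arc_length_integral m (\<lambda>i. \<gamma> i \<tau>)
       (\<lambda>q. heat_kernel (x - q) (t - \<tau>) * \<sigma> q \<tau>))"

text \<open>
  The point with local coordinates \<open>(s, r)\<close> in the positively oriented frame with origin \<open>x0\<close>
  whose second axis points in the direction of the unit vector \<open>n\<close>.
\<close>

definition local_point :: "real^2 \<Rightarrow> real^2 \<Rightarrow> real \<Rightarrow> real \<Rightarrow> real^2" where
  "local_point x0 n s r = x0 + s *\<^sub>R vector [n $ 2, - (n $ 1)] + r *\<^sub>R n"

text \<open>
  For all times \<open>\<tau> \<in> [0,t]\<close>, the graph of \<open>y(\<cdot>, \<tau>)\<close> over \<open>(-L, L)\<close> is part of the boundary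
  \<open>\<Gamma> \<tau>\<close>, and all other points of \<open>\<Gamma> \<tau>\<close> have distance at least \<open>\<delta>\<close> from \<open>x0\<close>.
\<close>

definition local_graph ::
  "real \<Rightarrow> real \<Rightarrow> (real \<Rightarrow> (real^2) set) \<Rightarrow> real \<Rightarrow> real^2 \<Rightarrow> real^2 \<Rightarrow> (real \<Rightarrow> real \<Rightarrow> real) \<Rightarrow> bool" where
  "local_graph L \<delta> \<Gamma> t x0 n y \<longleftrightarrow>
     (\<forall>\<tau>\<in>{0..t}.
        (let P = (\<lambda>s. local_point x0 n s (y s \<tau>)) ` {-L<..<L}
         in P \<subseteq> \<Gamma> \<tau> \<and> (\<forall>q\<in>\<Gamma> \<tau> - P. \<delta> \<le> dist q x0))) \<and>
     y 0 t = 0 \<and> deriv (\<lambda>s. y s t) 0 = 0"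

definition curvature_at :: "real \<Rightarrow> (real \<Rightarrow> real \<Rightarrow> real) \<Rightarrow> real" where
  "curvature_at t y = deriv (deriv (\<lambda>s. y s t)) 0"

text \<open>The graph is only given up to time \<open>t\<close>, hence the one-sided time derivative.\<close>

definition normal_velocity_at :: "real \<Rightarrow> (real \<Rightarrow> real \<Rightarrow> real) \<Rightarrow> real" where
  "normal_velocity_at t y = vector_derivative (\<lambda>\<tau>. y 0 \<tau>) (at t within {0..t})"

text \<open>
  \<open>f\<close> is \<open>k\<close> times (Frechet) differentiable on \<open>A\<close>, and its partial derivatives up to order \<open>k\<close>,
  including \<open>f\<close> itself, are bounded by \<open>M\<close> in absolute value.
\<close>

primrec bounded_differentiable ::
  "nat \<Rightarrow> real \<Rightarrow> (real \<times> real) set \<Rightarrow> (real \<times> real \<Rightarrow> real) \<Rightarrow> bool" where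
  "bounded_differentiable 0 M A f \<longleftrightarrow> (\<forall>z\<in>A. \<bar>f z\<bar> \<le> M)"
| "bounded_differentiable (Suc k) M A f \<longleftrightarrow>
     (\<forall>z\<in>A. \<bar>f z\<bar> \<le> M) \<and>
     (\<exists>f1 f2.
        (\<forall>z\<in>A. (f has_derivative (\<lambda>h. f1 z * fst h + f2 z * snd h)) (at z within A)) \<and>
        bounded_differentiable k M A f1 \<and> bounded_differentiable k M A f2)"

end

theory Submission
  imports Defs "HOL-Probability.Distributions"
begin

text \<open>
  The heat kernel at the elapsed time \<open>u = t - \<tau>\<close> only sees the part of the boundary at distance
  \<open>O(sqrt u)\<close> from the target, and there the boundary is, to the accuracy needed, the parabola
  \<open>y(s, t - u) = \<kappa> s\<^sup>2 / 2 - v u\<close>.  With \<open>r = c sqrt t\<close> the squared distance from the target to a graph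
  point is \<open>s\<^sup>2 + (r - y)\<^sup>2\<close>, so that
  \<open>G = exp (- r\<^sup>2 / 4u) / (4 pi u) * exp (- s\<^sup>2 / 4u) * exp ((2 r y - y\<^sup>2) / 4u)\<close>.
  In the variable \<open>s / sqrt u\<close> the last exponent is of size \<open>sqrt t\<close>, and up to \<open>O(t)\<close> the last factor is
  \<open>1 + r (\<kappa> s\<^sup>2 / 4u - v / 2)\<close>.  The density contributes \<open>\<sigma>0 + \<sigma>1 s + O(s\<^sup>2 + u)\<close>, the arc length
  element only \<open>1 + O(s\<^sup>2 + u\<^sup>2)\<close>.  The Gaussian integral annihilates the odd term \<open>\<sigma>1 s\<close> and replaces
  \<open>s\<^sup>2\<close> by \<open>2 u\<close>, so that the spatial integral is
    \<open>exp (- r\<^sup>2 / 4u) / sqrt (4 pi u) * \<sigma>0 * (1 + (\<kappa> - v) / 2 * r) + O(t / sqrt u)\<close>,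
  which is the content of \<open>graph_potential_expansion\<close>.

  Integrating over \<open>u\<close> in \<open>(0, t)\<close> turns the error into \<open>O(t sqrt t)\<close>, and the substitution \<open>u = t / z\<close>
  turns the leading term into \<open>E\<close> of order \<open>3/2\<close> at \<open>c\<^sup>2 / 4\<close> (\<open>exp_integral_as_time_integral\<close>).  Every
  estimate is pointwise in \<open>u\<close> and uniform in \<open>t\<close>: the graph and the density on it enter only through the
  bound \<open>M\<close> on their derivatives, and the rest of the boundary only through bounds for the density and the
  speed of the parametrization.

  Two facts connect this computation with the geometric potential.  Taylor expansion along the two
  coordinate directions provides the expansions of the graph and of the density
  (\<open>second_order_contact_of_graph\<close>).  A change of variables identifies the arc length integral
  over the closed curves with the integral over the graph, up to the curve points at distance at least
  \<open>\<delta>\<close> (\<open>arc_length_integral_near_graph\<close>), where the kernel is \<open>O(u)\<close>.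
\<close>

section \<open>Second-order contact of the boundary with a moving parabola\<close>

lemma increment_bound:
  fixes g g' :: "real \<Rightarrow> real"
  assumes "\<And>x. x \<in> closed_segment a b \<Longrightarrow> (g has_real_derivative g' x) (at x within closed_segment a b)"
    and "\<And>x. x \<in> closed_segment a b \<Longrightarrow> \<bar>g' x\<bar> \<le> B"
  shows "\<bar>g b - g a\<bar> \<le> B * \<bar>b - a\<bar>"
  using field_differentiable_bound[of "closed_segment a b" g g' B b a] assms by auto

text \<open>
  The bound is one-sided in \<open>z\<close> because the exponent to which it is applied contains \<open>- y\<^sup>2 / 4u\<close>, which may be
  very negative, and only its positive part has to be controlled by the Gaussian.
\<close>

lemma exp_remainder_bound:
  fixes z b :: real
  assumes "z \<le> b" "0 \<le> b"
  shows "\<bar>exp z - 1 - z\<bar> \<le> z\<^sup>2 * exp b"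
proof -
  have *: "\<bar>exp x - 1\<bar> \<le> exp b * \<bar>x\<bar>" if "x \<in> closed_segment 0 z" for x
  proof -
    have "\<bar>exp x - exp 0\<bar> \<le> exp b * \<bar>x - 0\<bar>"
      by (rule increment_bound[where g' = exp])
        (use that assms in \<open>auto intro!: derivative_eq_intros simp: closed_segment_eq_real_ivl split: if_splits\<close>)
    then show ?thesis by simp
  qed
  have "\<bar>(exp z - z) - (exp 0 - 0)\<bar> \<le> (exp b * \<bar>z\<bar>) * \<bar>z - 0\<bar>"
  proof (rule increment_bound[where g' = "\<lambda>x. exp x - 1"])
    fix x assume x: "x \<in> closed_segment 0 z"
    show "((\<lambda>x. exp x - x) has_real_derivative exp x - 1) (at x within closed_segment 0 z)"
      by (auto intro!: derivative_eq_intros)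
    have "\<bar>x\<bar> \<le> \<bar>z\<bar>" using x by (auto simp: closed_segment_eq_real_ivl split: if_splits)
    then show "\<bar>exp x - 1\<bar> \<le> exp b * \<bar>z\<bar>"
      using *[OF x] by (meson exp_ge_zero mult_left_mono order_trans)
  qed
  then show ?thesis by (simp add: power2_eq_square algebra_simps abs_mult_self_eq)
qed

text \<open>
  The graph \<open>y\<close> (with slope \<open>g\<close>) at the time \<open>u\<close> before the final time agrees with the moving parabola
  \<open>\<kappa> s\<^sup>2 / 2 - v u\<close>, and the density \<open>a\<close> on it with \<open>a0 + a1 s\<close>, up to the first neglected order in the parabolic
  scaling in which \<open>u\<close> counts like \<open>s\<^sup>2\<close>.  The term \<open>u\<^sup>2\<close> in the first bound is of even higher order.
\<close>

definition second_order_contact ::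
  "real \<Rightarrow> real \<Rightarrow> real \<Rightarrow> real \<Rightarrow> real \<Rightarrow> real \<Rightarrow> real \<Rightarrow>
    (real \<Rightarrow> real) \<Rightarrow> (real \<Rightarrow> real) \<Rightarrow> (real \<Rightarrow> real) \<Rightarrow> bool" where
  "second_order_contact M L u \<kappa> v a0 a1 y g a \<longleftrightarrow>
     \<bar>\<kappa>\<bar> \<le> M \<and> \<bar>v\<bar> \<le> M \<and> \<bar>a0\<bar> \<le> M \<and> \<bar>a1\<bar> \<le> M \<and>
     (\<forall>s\<in>{-L<..<L}.
        \<bar>y s - (\<kappa> * s\<^sup>2 / 2 - v * u)\<bar> \<le> M * (\<bar>s\<bar> ^ 3 + \<bar>s\<bar> * u + u\<^sup>2) \<and>
        \<bar>g s\<bar> \<le> M * (\<bar>s\<bar> + u) \<and>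
        \<bar>a s\<bar> \<le> M \<and> \<bar>a s - a0 - a1 * s\<bar> \<le> M * (s\<^sup>2 + u))"

lemma bounded_differentiable_bound:
  "bounded_differentiable k M A f \<Longrightarrow> z \<in> A \<Longrightarrow> \<bar>f z\<bar> \<le> M"
  by (cases k) auto

lemma partial_derivatives_on_strip:
  fixes f f1 f2 :: "real \<times> real \<Rightarrow> real"
  assumes der: "\<forall>z\<in>I \<times> J. (f has_derivative (\<lambda>h. f1 z * fst h + f2 z * snd h)) (at z within I \<times> J)"
    and z: "s \<in> I" "\<tau> \<in> J"
  shows "((\<lambda>x. f (x, \<tau>)) has_real_derivative f1 (s, \<tau>)) (at s within I)"
    and "((\<lambda>x. f (s, x)) has_real_derivative f2 (s, \<tau>)) (at \<tau> within J)"
proof -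
  have D: "(f has_derivative (\<lambda>h. f1 (s, \<tau>) * fst h + f2 (s, \<tau>) * snd h)) (at (s, \<tau>) within I \<times> J)"
    using der z by blast
  have "((\<lambda>x. f (x, \<tau>)) has_derivative (\<lambda>h. f1 (s, \<tau>) * fst (h, 0::real) + f2 (s, \<tau>) * snd (h, 0::real))) (at s within I)"
    by (rule has_derivative_in_compose[where f = "\<lambda>x. (x, \<tau>)" and g = f])
      (use z in \<open>auto intro!: derivative_eq_intros has_derivative_subset[OF D]\<close>)
  then show "((\<lambda>x. f (x, \<tau>)) has_real_derivative f1 (s, \<tau>)) (at s within I)"
    by (simp add: has_field_derivative_def)
  have "((\<lambda>x. f (s, x)) has_derivative (\<lambda>h. f1 (s, \<tau>) * fst (0::real, h) + f2 (s, \<tau>) * snd (0::real, h))) (at \<tau> within J)"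
    by (rule has_derivative_in_compose[where f = "\<lambda>x. (s, x)" and g = f])
      (use z in \<open>auto intro!: derivative_eq_intros has_derivative_subset[OF D]\<close>)
  then show "((\<lambda>x. f (s, x)) has_real_derivative f2 (s, \<tau>)) (at \<tau> within J)"
    by (simp add: has_field_derivative_def)
qed

text \<open>
  Expansion first in \<open>s\<close> at the final time \<open>t\<close>, then in time along the line of constant \<open>s\<close>.  Since the graph is
  only given up to time \<open>t\<close>, the time derivatives are one-sided, and all increments are estimated by the
  mean value inequality on segments inside the strip.
\<close>

lemma second_order_contact_of_graph:
  fixes y a :: "real \<Rightarrow> real \<Rightarrow> real"
  assumes t: "0 < t" and L: "0 < L"
    and y: "bounded_differentiable 4 M ({-L<..<L} \<times> {0..t}) (\<lambda>(s, \<tau>). y s \<tau>)"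
    and a: "bounded_differentiable 4 M ({-L<..<L} \<times> {0..t}) (\<lambda>(s, \<tau>). a s \<tau>)"
    and y0: "y 0 t = 0" "deriv (\<lambda>s. y s t) 0 = 0"
  obtains g a1 where
    "\<And>s \<tau>. s \<in> {-L<..<L} \<Longrightarrow> \<tau> \<in> {0..t} \<Longrightarrow> ((\<lambda>x. y x \<tau>) has_real_derivative g s \<tau>) (at s)"
    "\<And>\<tau>. \<tau> \<in> {0..t} \<Longrightarrow>
      second_order_contact M L (t - \<tau>) (curvature_at t y) (normal_velocity_at t y) (a 0 t) a1
        (\<lambda>s. y s \<tau>) (\<lambda>s. g s \<tau>) (\<lambda>s. a s \<tau>)"
proof -
  let ?I = "{-L<..<L}" and ?J = "{0..t}"
  have y': "bounded_differentiable (Suc (Suc (Suc (Suc 0)))) M (?I \<times> ?J) (\<lambda>(s, \<tau>). y s \<tau>)"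
    and a': "bounded_differentiable (Suc (Suc (Suc (Suc 0)))) M (?I \<times> ?J) (\<lambda>(s, \<tau>). a s \<tau>)"
    using y a by (simp_all only: eval_nat_numeral BitM.simps numeral_One One_nat_def)
  obtain f1 f2 where
    f: "\<forall>z\<in>?I \<times> ?J. ((\<lambda>(s, \<tau>). y s \<tau>) has_derivative (\<lambda>h. f1 z * fst h + f2 z * snd h)) (at z within ?I \<times> ?J)"
    and f1: "bounded_differentiable (Suc (Suc (Suc 0))) M (?I \<times> ?J) f1"
    and f2: "bounded_differentiable (Suc (Suc (Suc 0))) M (?I \<times> ?J) f2"
    using y' unfolding bounded_differentiable.simps(2)[of "Suc (Suc (Suc 0))"] by blast
  obtain f11 f12 where
    df1: "\<forall>z\<in>?I \<times> ?J. (f1 has_derivative (\<lambda>h. f11 z * fst h + f12 z * snd h)) (at z within ?I \<times> ?J)"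
    and f11: "bounded_differentiable (Suc (Suc 0)) M (?I \<times> ?J) f11"
    and f12: "bounded_differentiable (Suc (Suc 0)) M (?I \<times> ?J) f12"
    using f1 unfolding bounded_differentiable.simps(2)[of "Suc (Suc 0)"] by blast
  obtain f111 f112 where
    df11: "\<forall>z\<in>?I \<times> ?J. (f11 has_derivative (\<lambda>h. f111 z * fst h + f112 z * snd h)) (at z within ?I \<times> ?J)"
    and f111: "bounded_differentiable (Suc 0) M (?I \<times> ?J) f111"
    using f11 unfolding bounded_differentiable.simps(2)[of "Suc 0"] by blast
  obtain f21 f22 where
    df2: "\<forall>z\<in>?I \<times> ?J. (f2 has_derivative (\<lambda>h. f21 z * fst h + f22 z * snd h)) (at z within ?I \<times> ?J)"
    and f21: "bounded_differentiable (Suc (Suc 0)) M (?I \<times> ?J) f21"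
    and f22: "bounded_differentiable (Suc (Suc 0)) M (?I \<times> ?J) f22"
    using f2 unfolding bounded_differentiable.simps(2)[of "Suc (Suc 0)"] by blast
  obtain b1 b2 where
    da: "\<forall>z\<in>?I \<times> ?J. ((\<lambda>(s, \<tau>). a s \<tau>) has_derivative (\<lambda>h. b1 z * fst h + b2 z * snd h)) (at z within ?I \<times> ?J)"
    and b1: "bounded_differentiable (Suc (Suc (Suc 0))) M (?I \<times> ?J) b1"
    and b2: "bounded_differentiable (Suc (Suc (Suc 0))) M (?I \<times> ?J) b2"
    using a' unfolding bounded_differentiable.simps(2)[of "Suc (Suc (Suc 0))"] by blast
  obtain b11 b12 where
    db1: "\<forall>z\<in>?I \<times> ?J. (b1 has_derivative (\<lambda>h. b11 z * fst h + b12 z * snd h)) (at z within ?I \<times> ?J)"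
    and b11: "bounded_differentiable (Suc (Suc 0)) M (?I \<times> ?J) b11"
    using b1 unfolding bounded_differentiable.simps(2)[of "Suc (Suc 0)"] by blast
  note B = bounded_differentiable_bound
  note ds = partial_derivatives_on_strip(1)[of ?I ?J] and dt = partial_derivatives_on_strip(2)[of ?I ?J]
  have tJ: "t \<in> ?J" and I0: "0 \<in> ?I" using t L by auto
  have sub: "closed_segment 0 s \<subseteq> ?I" if "s \<in> ?I" for s
    using that L by (auto simp: closed_segment_eq_real_ivl split: if_splits)
  have subt: "closed_segment t \<tau> \<subseteq> ?J" if "\<tau> \<in> ?J" for \<tau>
    using that by (auto simp: closed_segment_eq_real_ivl split: if_splits)
  have le: "\<bar>x\<bar> \<le> \<bar>s\<bar>" if "x \<in> closed_segment 0 s" for x s :: real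
    using that by (auto simp: closed_segment_eq_real_ivl split: if_splits)
  have le_t: "\<bar>x - t\<bar> \<le> \<bar>\<tau> - t\<bar>" if "x \<in> closed_segment t \<tau>" for x \<tau> :: real
    using that by (auto simp: closed_segment_eq_real_ivl split: if_splits)
  have M0: "0 \<le> M" using B[OF y, of "(0, t)"] I0 tJ by auto
  have inc_s: "\<bar>h (s, \<tau>) - h (0, \<tau>)\<bar> \<le> M * \<bar>s\<bar>"
    if "\<forall>z\<in>?I \<times> ?J. (h has_derivative (\<lambda>k. h1 z * fst k + h2 z * snd k)) (at z within ?I \<times> ?J)"
      and "s \<in> ?I" "\<tau> \<in> ?J" and "bounded_differentiable k M (?I \<times> ?J) h1"
    for h h1 h2 :: "real \<times> real \<Rightarrow> real" and s \<tau> k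
  proof -
    have "\<bar>h (s, \<tau>) - h (0, \<tau>)\<bar> \<le> M * \<bar>s - 0\<bar>"
      by (rule increment_bound[where g = "\<lambda>x. h (x, \<tau>)" and g' = "\<lambda>x. h1 (x, \<tau>)"])
        (use that sub[OF that(2)] in \<open>auto intro!: DERIV_subset[OF ds[OF that(1)]] B[OF that(4)]\<close>)
    then show ?thesis by simp
  qed
  have inc_t: "\<bar>h (s, \<tau>) - h (s, t)\<bar> \<le> M * (t - \<tau>)"
    if "\<forall>z\<in>?I \<times> ?J. (h has_derivative (\<lambda>k. h1 z * fst k + h2 z * snd k)) (at z within ?I \<times> ?J)"
      and "s \<in> ?I" "\<tau> \<in> ?J" and "bounded_differentiable k M (?I \<times> ?J) h2"
    for h h1 h2 :: "real \<times> real \<Rightarrow> real" and s \<tau> k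
  proof -
    have "\<bar>h (s, \<tau>) - h (s, t)\<bar> \<le> M * \<bar>\<tau> - t\<bar>"
      by (rule increment_bound[where g = "\<lambda>x. h (s, x)" and g' = "\<lambda>x. h2 (s, x)"])
        (use that subt[OF that(3)] in \<open>auto intro!: DERIV_subset[OF dt[OF that(1)]] B[OF that(4)]\<close>)
    then show ?thesis using that by simp
  qed
  have dys: "((\<lambda>x. y x \<tau>) has_real_derivative f1 (s, \<tau>)) (at s)" if "s \<in> ?I" "\<tau> \<in> ?J" for s \<tau>
    using ds[OF f that] at_within_open[OF that(1)] by simp
  have f1_0: "f1 (0, t) = 0" using DERIV_imp_deriv[OF dys[OF I0 tJ]] y0 by simp
  have \<kappa>: "curvature_at t y = f11 (0, t)"
  proof -
    have "eventually (\<lambda>s. s \<in> ?I) (nhds 0)" using I0 by (intro eventually_nhds_in_open) auto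
    then have "eventually (\<lambda>s. deriv (\<lambda>x. y x t) s = f1 (s, t)) (nhds 0)"
      by eventually_elim (use DERIV_imp_deriv[OF dys[OF _ tJ]] in auto)
    then have "deriv (deriv (\<lambda>x. y x t)) 0 = deriv (\<lambda>s. f1 (s, t)) 0" by (rule deriv_cong_ev) simp
    also have "\<dots> = f11 (0, t)"
      using ds[OF df1 I0 tJ] at_within_open[OF I0] by (intro DERIV_imp_deriv) simp
    finally show ?thesis by (simp add: curvature_at_def)
  qed
  have v: "normal_velocity_at t y = f2 (0, t)"
  proof -
    have "((\<lambda>\<tau>. y 0 \<tau>) has_vector_derivative f2 (0, t)) (at t within ?J)"
      using dt[OF f I0 tJ] by (simp add: has_real_derivative_iff_has_vector_derivative)
    moreover have "at t within ?J \<noteq> bot" using t by (simp add: at_within_Icc_at_left)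
    ultimately show ?thesis unfolding normal_velocity_at_def by (intro vector_derivative_within)
  qed
  have fin: "second_order_contact M L (t - \<tau>) (curvature_at t y) (normal_velocity_at t y) (a 0 t) (b1 (0, t))
        (\<lambda>s. y s \<tau>) (\<lambda>s. f1 (s, \<tau>)) (\<lambda>s. a s \<tau>)" if \<tau>: "\<tau> \<in> ?J" for \<tau>
    unfolding second_order_contact_def \<kappa> v
  proof (intro conjI ballI)
    show "\<bar>f11 (0, t)\<bar> \<le> M" "\<bar>f2 (0, t)\<bar> \<le> M" "\<bar>b1 (0, t)\<bar> \<le> M"
      using B[OF f11] B[OF f2] B[OF b1] I0 tJ by auto
    show "\<bar>a 0 t\<bar> \<le> M" using B[OF a, of "(0, t)"] I0 tJ by auto
    fix s assume s: "s \<in> ?I"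
    let ?u = "t - \<tau>"
    have u: "0 \<le> ?u" using \<tau> by auto
    have sx: "x \<in> ?I" if "x \<in> closed_segment 0 s" for x using sub[OF s] that by auto
    have tx: "x \<in> ?J" if "x \<in> closed_segment t \<tau>" for x using subt[OF \<tau>] that by auto
    show "\<bar>a s \<tau>\<bar> \<le> M" using B[OF a, of "(s, \<tau>)"] s \<tau> by auto
    have f1s: "\<bar>f1 (x, t)\<bar> \<le> M * \<bar>x\<bar>" if "x \<in> ?I" for x
      using inc_s[OF df1 that tJ f11] f1_0 by simp
    have "\<bar>f1 (s, \<tau>) - f1 (s, t)\<bar> \<le> M * ?u"
      by (rule inc_t[OF df1 s \<tau> f12])
    then show "\<bar>f1 (s, \<tau>)\<bar> \<le> M * (\<bar>s\<bar> + ?u)" using f1s[OF s] by (simp add: distrib_left)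
    have yt: "\<bar>y s t - f11 (0, t) * s\<^sup>2 / 2\<bar> \<le> M * \<bar>s\<bar> ^ 3"
    proof -
      have c2: "\<bar>f11 (x, t) - f11 (0, t)\<bar> \<le> M * \<bar>x\<bar>" if "x \<in> ?I" for x
        by (rule inc_s[OF df11 that tJ f111])
      have c1: "\<bar>f1 (x, t) - f11 (0, t) * x\<bar> \<le> M * \<bar>x\<bar>\<^sup>2" if x: "x \<in> ?I" for x
      proof -
        have "\<bar>(f1 (x, t) - f11 (0, t) * x) - (f1 (0, t) - f11 (0, t) * 0)\<bar> \<le> M * \<bar>x\<bar> * \<bar>x - 0\<bar>"
        proof (rule increment_bound[where g' = "\<lambda>x. f11 (x, t) - f11 (0, t)"])
          fix w assume w: "w \<in> closed_segment 0 x"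
          then have wI: "w \<in> ?I" using sub[OF x] by auto
          show "((\<lambda>x. f1 (x, t) - f11 (0, t) * x) has_real_derivative f11 (w, t) - f11 (0, t))
              (at w within closed_segment 0 x)"
            by (auto intro!: derivative_eq_intros DERIV_subset[OF ds[OF df1 wI tJ] sub[OF x]])
          show "\<bar>f11 (w, t) - f11 (0, t)\<bar> \<le> M * \<bar>x\<bar>"
            using c2[OF wI] mult_left_mono[OF le[OF w] M0] by linarith
        qed
        then show ?thesis by (simp add: f1_0 power2_eq_square mult.assoc)
      qed
      have "\<bar>(y s t - f11 (0, t) * s\<^sup>2 / 2) - (y 0 t - f11 (0, t) * 0\<^sup>2 / 2)\<bar> \<le> M * \<bar>s\<bar>\<^sup>2 * \<bar>s - 0\<bar>"
      proof (rule increment_bound[where g' = "\<lambda>x. f1 (x, t) - f11 (0, t) * x"])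
        fix w assume w: "w \<in> closed_segment 0 s"
        then have wI: "w \<in> ?I" using sub[OF s] by auto
        show "((\<lambda>s. y s t - f11 (0, t) * s\<^sup>2 / 2) has_real_derivative f1 (w, t) - f11 (0, t) * w)
            (at w within closed_segment 0 s)"
          by (auto intro!: derivative_eq_intros has_field_derivative_at_within[OF dys[OF wI tJ]])
        have "M * \<bar>w\<bar>\<^sup>2 \<le> M * \<bar>s\<bar>\<^sup>2" using le[OF w] M0 by (intro mult_left_mono power_mono) auto
        then show "\<bar>f1 (w, t) - f11 (0, t) * w\<bar> \<le> M * \<bar>s\<bar>\<^sup>2" using c1[OF wI] by linarith
      qed
      then show ?thesis by (simp add: y0 power3_eq_cube power2_eq_square mult.assoc)
    qed
    have y\<tau>: "\<bar>y s \<tau> - y s t + f2 (s, t) * ?u\<bar> \<le> M * ?u\<^sup>2"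
    proof -
      have "\<bar>(y s \<tau> - f2 (s, t) * \<tau>) - (y s t - f2 (s, t) * t)\<bar> \<le> M * \<bar>\<tau> - t\<bar> * \<bar>\<tau> - t\<bar>"
      proof (rule increment_bound[where g' = "\<lambda>x. f2 (s, x) - f2 (s, t)"])
        fix w assume w: "w \<in> closed_segment t \<tau>"
        have "((\<lambda>x. y s x) has_real_derivative f2 (s, w)) (at w within closed_segment t \<tau>)"
          using DERIV_subset[OF dt[OF f s tx[OF w]] subt[OF \<tau>]] by simp
        then show "((\<lambda>x. y s x - f2 (s, t) * x) has_real_derivative f2 (s, w) - f2 (s, t))
            (at w within closed_segment t \<tau>)"
          by (auto intro!: derivative_eq_intros)
        have "\<bar>f2 (s, w) - f2 (s, t)\<bar> \<le> M * (t - w)"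
          by (rule inc_t[OF df2 s tx[OF w] f22])
        also have "\<dots> \<le> M * \<bar>\<tau> - t\<bar>" using le_t[OF w] M0 by (intro mult_left_mono) auto
        finally show "\<bar>f2 (s, w) - f2 (s, t)\<bar> \<le> M * \<bar>\<tau> - t\<bar>" .
      qed
      moreover have "(y s \<tau> - f2 (s, t) * \<tau>) - (y s t - f2 (s, t) * t) = y s \<tau> - y s t + f2 (s, t) * ?u"
        by (simp add: algebra_simps)
      moreover have "M * \<bar>\<tau> - t\<bar> * \<bar>\<tau> - t\<bar> = M * ?u\<^sup>2" using u by (simp add: power2_eq_square)
      ultimately show ?thesis by simp
    qed
    have "\<bar>f2 (s, t) - f2 (0, t)\<bar> \<le> M * \<bar>s\<bar>"
      by (rule inc_s[OF df2 s tJ f21])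
    then have "\<bar>f2 (s, t) - f2 (0, t)\<bar> * ?u \<le> M * \<bar>s\<bar> * ?u" by (rule mult_right_mono[OF _ u])
    then have v': "\<bar>f2 (s, t) * ?u - f2 (0, t) * ?u\<bar> \<le> M * \<bar>s\<bar> * ?u"
      using u by (simp only: abs_mult left_diff_distrib[symmetric] abs_of_nonneg)
    have "M * (\<bar>s\<bar> ^ 3 + \<bar>s\<bar> * ?u + ?u\<^sup>2) = M * \<bar>s\<bar> ^ 3 + M * \<bar>s\<bar> * ?u + M * ?u\<^sup>2"
      by (simp only: distrib_left mult.assoc)
    then show "\<bar>y s \<tau> - (f11 (0, t) * s\<^sup>2 / 2 - f2 (0, t) * ?u)\<bar> \<le> M * (\<bar>s\<bar> ^ 3 + \<bar>s\<bar> * ?u + ?u\<^sup>2)"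
      using yt y\<tau> v' by linarith
    have a1: "\<bar>a s \<tau> - a s t\<bar> \<le> M * ?u"
      using inc_t[OF da s \<tau> b2] by simp
    have a2: "\<bar>a s t - a 0 t - b1 (0, t) * s\<bar> \<le> M * s\<^sup>2"
    proof -
      have "\<bar>(a s t - b1 (0, t) * s) - (a 0 t - b1 (0, t) * 0)\<bar> \<le> M * \<bar>s\<bar> * \<bar>s - 0\<bar>"
      proof (rule increment_bound[where g' = "\<lambda>x. b1 (x, t) - b1 (0, t)"])
        fix w assume w: "w \<in> closed_segment 0 s"
        have "((\<lambda>x. a x t) has_real_derivative b1 (w, t)) (at w within closed_segment 0 s)"
          using DERIV_subset[OF ds[OF da sx[OF w] tJ] sub[OF s]] by simp
        then show "((\<lambda>x. a x t - b1 (0, t) * x) has_real_derivative b1 (w, t) - b1 (0, t))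
            (at w within closed_segment 0 s)"
          by (auto intro!: derivative_eq_intros)
        have "\<bar>b1 (w, t) - b1 (0, t)\<bar> \<le> M * \<bar>w\<bar>"
          by (rule inc_s[OF db1 sx[OF w] tJ b11])
        then show "\<bar>b1 (w, t) - b1 (0, t)\<bar> \<le> M * \<bar>s\<bar>"
          using mult_left_mono[OF le[OF w] M0] by linarith
      qed
      then show ?thesis by (simp add: power2_eq_square mult.assoc algebra_simps)
    qed
    show "\<bar>a s \<tau> - a 0 t - b1 (0, t) * s\<bar> \<le> M * (s\<^sup>2 + ?u)"
      using a1 a2 unfolding distrib_left by linarith
  qed
  show ?thesis
    by (rule that[of "\<lambda>s \<tau>. f1 (s, \<tau>)" "b1 (0, t)"]) (fact dys, fact fin)
qed

section \<open>Gaussian expansion of the potential of a graph\<close>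

text \<open>
  The quantity \<open>q = 1 + s\<^sup>2 / u\<close> measures the parabolic scale: \<open>s\<^sup>2 + u = u q\<close>, and everything of order \<open>u\<close> is at
  most \<open>u\<close> times a power of \<open>q\<close>.  The exponent \<open>z\<close> is \<open>O(sqrt t q\<^sup>2)\<close> with linear part
  \<open>z0 = r (\<kappa> s\<^sup>2 / 4u - v / 2)\<close> up to \<open>O(t q\<^sup>2)\<close>.  The smallness assumption on \<open>t\<close> keeps \<open>z\<close> below \<open>q / 8\<close>; the
  resulting growth \<open>exp (q / 8)\<close> is weaker than the decay \<open>exp (- s\<^sup>2 / 4u)\<close> of the heat kernel.
\<close>

lemma local_expansion:
  fixes M L c :: real
  assumes M: "0 \<le> M" and L: "0 < L"
  obtains C where "0 \<le> C" and "\<And>t u s y g a a0 a1 \<kappa> v.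
    \<lbrakk>0 < u; u \<le> t; t \<le> 1; 4 * \<bar>c\<bar> * (M * (3 + L)) * sqrt t \<le> 1;
     second_order_contact M L u \<kappa> v a0 a1 y g a; s \<in> {-L<..<L}\<rbrakk> \<Longrightarrow>
    \<bar>exp ((2 * (c * sqrt t) * y s - (y s)\<^sup>2) / (4 * u)) * (a s * sqrt (1 + (g s)\<^sup>2))
      - (a0 * (1 + c * sqrt t * (\<kappa> * s\<^sup>2 / (4 * u) - v / 2)) + a1 * s)\<bar>
    \<le> C * t * ((1 + s\<^sup>2 / u) ^ 4 * exp ((1 + s\<^sup>2 / u) / 8))"
proof -
  define K where "K = M * (3 + L)"
  define C1 where "C1 = \<bar>c\<bar> * M + K\<^sup>2"
  define C2 where "C2 = \<bar>c\<bar> * M + C1"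
  define C3 where "C3 = M * (1 + (M * (L + 1))\<^sup>2)"
  define C4 where "C4 = M + M * (2 * M\<^sup>2)"
  define C where "C = (C2\<^sup>2 + C1) * C3 + (1 + \<bar>c\<bar> * M) * C4 + \<bar>c\<bar> * M * M"
  have K0: "0 \<le> K" and C0: "0 \<le> C1" "0 \<le> C2" "0 \<le> C3" "0 \<le> C4" "0 \<le> C"
    using M L by (simp_all add: K_def C1_def C2_def C3_def C4_def C_def)
  have *: "\<bar>exp ((2 * (c * sqrt t) * y' s - (y' s)\<^sup>2) / (4 * u)) * (a' s * sqrt (1 + (g' s)\<^sup>2))
      - (a0 * (1 + c * sqrt t * (\<kappa> * s\<^sup>2 / (4 * u) - v / 2)) + a1 * s)\<bar>
    \<le> C * t * ((1 + s\<^sup>2 / u) ^ 4 * exp ((1 + s\<^sup>2 / u) / 8))"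
    if u: "0 < u" "u \<le> t" "t \<le> 1" and small: "4 * \<bar>c\<bar> * (M * (3 + L)) * sqrt t \<le> 1"
    and contact: "second_order_contact M L u \<kappa> v a0 a1 y' g' a'" and sL: "s \<in> {-L<..<L}"
    for t u s a0 a1 \<kappa> v :: real and y' g' a' :: "real \<Rightarrow> real"
  proof -
    define d where "d = y' s"
    define g where "g = g' s"
    define a where "a = a' s"
    have s: "\<bar>s\<bar> \<le> L" using sL by auto
    have kv: "\<bar>\<kappa>\<bar> \<le> M" "\<bar>v\<bar> \<le> M"
      and d: "\<bar>d - (\<kappa> * s\<^sup>2 / 2 - v * u)\<bar> \<le> M * (\<bar>s\<bar> ^ 3 + \<bar>s\<bar> * u + u\<^sup>2)"
      and g: "\<bar>g\<bar> \<le> M * (\<bar>s\<bar> + u)"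
      and a: "\<bar>a\<bar> \<le> M" "\<bar>a0\<bar> \<le> M" "\<bar>a1\<bar> \<le> M" "\<bar>a - a0 - a1 * s\<bar> \<le> M * (s\<^sup>2 + u)"
      using contact sL by (auto simp: second_order_contact_def d_def g_def a_def)
    define q where "q = 1 + s\<^sup>2 / u"
    define \<rho> where "\<rho> = sqrt u"
    define \<theta> where "\<theta> = sqrt t"
    define d0 where "d0 = \<kappa> * s\<^sup>2 / 2 - v * u"
    define z where "z = (2 * (c * \<theta>) * d - d\<^sup>2) / (4 * u)"
    define z0 where "z0 = c * \<theta> * d0 / (2 * u)"
    have t: "0 < t" using u by simp
    have \<rho>: "0 < \<rho>" "\<rho>\<^sup>2 = u" "\<rho> \<le> 1" using u by (auto simp: \<rho>_def)
    have \<theta>: "0 < \<theta>" "\<theta>\<^sup>2 = t" "\<theta> \<le> 1" "\<rho> \<le> \<theta>" using u by (auto simp: \<theta>_def \<rho>_def)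
    have q1: "1 \<le> q" using u by (simp add: q_def)
    have uq: "s\<^sup>2 + u = u * q" using u by (simp add: q_def field_simps)
    have sq: "\<bar>s\<bar> \<le> \<rho> * q"
    proof -
      have "q \<le> q\<^sup>2" using q1 by (simp add: power2_eq_square)
      then have "u * q \<le> u * q\<^sup>2" using u by simp
      then have "s\<^sup>2 \<le> u * q\<^sup>2" using uq u by linarith
      then have "\<bar>s\<bar>\<^sup>2 \<le> (\<rho> * q)\<^sup>2" using \<rho> by (simp add: power_mult_distrib)
      then show ?thesis using \<rho> q1 by - (rule power2_le_imp_le, auto)
    qed
    have uu: "u\<^sup>2 \<le> \<rho> * (u * q)"
    proof -
      have "u\<^sup>2 = \<rho> * (u * \<rho>)" using \<rho> by (simp add: power2_eq_square)
      also have "\<dots> \<le> \<rho> * (u * q)" using \<rho> q1 u by (intro mult_left_mono) auto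
      finally show ?thesis .
    qed
    have cub: "\<bar>s\<bar> ^ 3 + \<bar>s\<bar> * u + u\<^sup>2 \<le> (\<bar>s\<bar> + \<rho>) * (u * q)"
    proof -
      have "\<bar>s\<bar> ^ 3 + \<bar>s\<bar> * u = \<bar>s\<bar> * (s\<^sup>2 + u)" by (simp add: power3_eq_cube power2_eq_square algebra_simps)
      also have "\<dots> = \<bar>s\<bar> * (u * q)" by (simp add: uq)
      finally show ?thesis using uu by (simp add: distrib_right)
    qed
    have d0: "\<bar>d0\<bar> \<le> M * (u * q)"
    proof -
      have "\<bar>d0\<bar> \<le> \<bar>\<kappa>\<bar> * s\<^sup>2 / 2 + \<bar>v\<bar> * u"
        unfolding d0_def using u by (auto simp: abs_mult intro!: order_trans[OF abs_triangle_ineq4])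
      also have "\<dots> \<le> M * s\<^sup>2 + M * u"
      proof (rule add_mono)
        have "\<bar>\<kappa>\<bar> * s\<^sup>2 \<le> M * s\<^sup>2" using kv by (intro mult_right_mono) auto
        then show "\<bar>\<kappa>\<bar> * s\<^sup>2 / 2 \<le> M * s\<^sup>2" using M by (smt (verit) field_sum_of_halves zero_le_power2 mult_nonneg_nonneg)
        show "\<bar>v\<bar> * u \<le> M * u" using kv u by (intro mult_right_mono) auto
      qed
      finally show ?thesis using uq by (metis distrib_left)
    qed
    have e1: "\<bar>d - d0\<bar> \<le> M * (2 * \<rho> * u * q\<^sup>2)"
    proof -
      have "\<rho> \<le> \<rho> * q" using \<rho> q1 by simp
      then have "(\<bar>s\<bar> + \<rho>) * (u * q) \<le> (2 * \<rho> * q) * (u * q)" using sq u q1 by (intro mult_right_mono) auto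
      then have "(\<bar>s\<bar> + \<rho>) * (u * q) \<le> 2 * \<rho> * u * q\<^sup>2" by (simp add: power2_eq_square mult_ac)
      then show ?thesis using d cub M unfolding d0_def by (meson mult_left_mono order_trans)
    qed
    have e2: "\<bar>d - d0\<bar> \<le> M * ((L + 1) * (u * q))"
    proof -
      have "(\<bar>s\<bar> + \<rho>) * (u * q) \<le> (L + 1) * (u * q)" using s \<rho> u q1 by (intro mult_right_mono) auto
      then show ?thesis using d cub M unfolding d0_def by (meson mult_left_mono order_trans)
    qed
    have dK: "\<bar>d\<bar> \<le> K * (u * q)"
    proof -
      have "\<bar>d\<bar> \<le> M * ((L + 1) * (u * q)) + M * (u * q)" using e2 d0 by linarith
      also have "\<dots> = K * (u * q) - M * (u * q)" by (simp add: K_def algebra_simps)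
      also have "\<dots> \<le> K * (u * q)" using M u q1 by simp
      finally show ?thesis .
    qed
    have q12: "q \<le> q\<^sup>2" using q1 by (simp add: power2_eq_square)
    have z0: "\<bar>z0\<bar> \<le> \<bar>c\<bar> * M * \<theta> * q"
    proof -
      have "\<bar>z0\<bar> = \<bar>c\<bar> * \<theta> * \<bar>d0\<bar> / (2 * u)" using \<theta> u by (simp add: z0_def abs_mult)
      also have "\<dots> \<le> \<bar>c\<bar> * \<theta> * (M * (u * q)) / (2 * u)"
        using d0 \<theta> u by (intro divide_right_mono mult_left_mono) auto
      also have "\<dots> = (\<bar>c\<bar> * M * \<theta> * q) / 2" using u by simp
      also have "\<dots> \<le> \<bar>c\<bar> * M * \<theta> * q" using M \<theta> q1 by simp
      finally show ?thesis .
    qed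
    have zz0: "\<bar>z - z0\<bar> \<le> C1 * t * q\<^sup>2"
    proof -
      have "z - z0 = c * \<theta> * (d - d0) / (2 * u) - d\<^sup>2 / (4 * u)"
        using u by (simp add: z_def z0_def field_simps)
      then have "\<bar>z - z0\<bar> \<le> \<bar>c * \<theta> * (d - d0) / (2 * u)\<bar> + \<bar>d\<^sup>2 / (4 * u)\<bar>" by linarith
      also have "\<dots> = \<bar>c\<bar> * \<theta> * \<bar>d - d0\<bar> / (2 * u) + \<bar>d\<bar>\<^sup>2 / (4 * u)" using \<theta> u by (simp add: abs_mult)
      also have "\<dots> \<le> \<bar>c\<bar> * \<theta> * (M * (2 * \<rho> * u * q\<^sup>2)) / (2 * u) + (K * (u * q))\<^sup>2 / (4 * u)"
        using e1 dK \<theta> u by (intro add_mono divide_right_mono mult_left_mono power_mono) auto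
      also have "\<dots> = \<bar>c\<bar> * M * q\<^sup>2 * (\<theta> * \<rho>) + K\<^sup>2 * q\<^sup>2 * (u / 4)"
        using u by (simp add: field_simps power2_eq_square)
      also have "\<dots> \<le> \<bar>c\<bar> * M * q\<^sup>2 * t + K\<^sup>2 * q\<^sup>2 * t"
      proof (intro add_mono mult_left_mono)
        have "\<theta> * \<rho> \<le> \<theta> * \<theta>" using \<theta> by (intro mult_left_mono) auto
        then show "\<theta> * \<rho> \<le> t" using \<theta>(2) by (metis power2_eq_square)
      qed (use u M in auto)
      also have "\<dots> = C1 * t * q\<^sup>2" by (simp add: C1_def algebra_simps)
      finally show ?thesis .
    qed
    have t\<theta>: "t \<le> \<theta>" using \<theta> by (metis mult_left_le less_imp_le power2_eq_square)
    have zC2: "\<bar>z\<bar> \<le> C2 * \<theta> * q\<^sup>2"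
    proof -
      have "\<bar>z\<bar> \<le> \<bar>c\<bar> * M * \<theta> * q + C1 * t * q\<^sup>2" using z0 zz0 by linarith
      also have "\<dots> \<le> \<bar>c\<bar> * M * \<theta> * q\<^sup>2 + C1 * \<theta> * q\<^sup>2"
        using q12 t\<theta> M \<theta> C0 by (intro add_mono mult_left_mono mult_right_mono) auto
      finally show ?thesis by (simp add: C2_def algebra_simps)
    qed
    have z2: "z\<^sup>2 \<le> C2\<^sup>2 * t * q ^ 4"
    proof -
      have "\<bar>z\<bar>\<^sup>2 \<le> (C2 * \<theta> * q\<^sup>2)\<^sup>2" using zC2 by (intro power_mono) auto
      then show ?thesis using \<theta> by (simp add: power_mult_distrib)
    qed
    \<comment> \<open>The negative term \<open>- d\<^sup>2 / (4 * u)\<close> is dropped, and the smallness of \<open>t\<close> controls the rest.\<close>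
    have zq: "z \<le> q / 8"
    proof -
      have "z \<le> \<bar>c * \<theta> * d / (2 * u)\<bar>"
      proof -
        have "z = c * \<theta> * d / (2 * u) - d\<^sup>2 / (4 * u)" using u by (simp add: z_def field_simps)
        moreover have "0 \<le> d\<^sup>2 / (4 * u)" using u by simp
        ultimately show ?thesis by linarith
      qed
      also have "\<dots> = \<bar>c\<bar> * \<theta> * \<bar>d\<bar> / (2 * u)" using \<theta> u by (simp add: abs_mult)
      also have "\<dots> \<le> \<bar>c\<bar> * \<theta> * (K * (u * q)) / (2 * u)"
        using dK \<theta> u by (intro divide_right_mono mult_left_mono) auto
      also have "\<dots> = (4 * \<bar>c\<bar> * K * \<theta>) * (q / 8)" using u by (simp add: field_simps)
      also have "\<dots> \<le> 1 * (q / 8)" using small q1 by (intro mult_right_mono) (auto simp: K_def \<theta>_def)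
      finally show ?thesis by simp
    qed
    define X where "X = t * (q ^ 4 * exp (q / 8))"
    have X0: "0 \<le> X" using t q1 by (simp add: X_def)
    have q4: "1 \<le> q ^ 4" "q \<le> q ^ 4" "q\<^sup>2 \<le> q ^ 4"
      using q1 power_increasing[of 1 4 q] power_increasing[of 2 4 q] by (auto simp: one_le_power)
    have e8: "1 \<le> exp (q / 8)" using q1 by simp
    have pX: "y * t * x \<le> y * X" if "0 \<le> y" "0 \<le> x" "x \<le> q ^ 4" for x y
    proof -
      have "x * 1 \<le> q ^ 4 * exp (q / 8)" using that q4 e8 by (intro mult_mono) auto
      then show ?thesis using that t by (simp add: X_def mult_left_mono mult.assoc)
    qed
    have nn: "0 \<le> (1 + \<bar>c\<bar> * M) * C4" "0 \<le> \<bar>c\<bar> * M * M" "0 \<le> \<bar>c\<bar> * M * \<theta> * q" using M C0 \<theta> q1 by simp_all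
    have eX: "\<bar>exp z - 1 - z0\<bar> \<le> (C2\<^sup>2 + C1) * X"
    proof -
      have "\<bar>exp z - 1 - z\<bar> \<le> z\<^sup>2 * exp (q / 8)" using exp_remainder_bound[OF zq] q1 by simp
      also have "\<dots> \<le> C2\<^sup>2 * t * q ^ 4 * exp (q / 8)" using z2 by (intro mult_right_mono) auto
      finally have "\<bar>exp z - 1 - z\<bar> \<le> C2\<^sup>2 * X" by (simp add: X_def mult_ac)
      moreover have "\<bar>z - z0\<bar> \<le> C1 * X" using zz0 pX[of C1 "q\<^sup>2"] C0 q4 by auto
      ultimately have "\<bar>exp z - 1 - z0\<bar> \<le> C2\<^sup>2 * X + C1 * X" by linarith
      then show ?thesis by (simp add: distrib_right)
    qed
    define H where "H = a * sqrt (1 + g\<^sup>2)"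
    have sqrt1: "1 \<le> sqrt (1 + g\<^sup>2)" "sqrt (1 + g\<^sup>2) \<le> 1 + g\<^sup>2"
    proof -
      show "1 \<le> sqrt (1 + g\<^sup>2)" by simp
      have "1 + g\<^sup>2 \<le> (1 + g\<^sup>2)\<^sup>2" using self_le_power[of "1 + g\<^sup>2" 2] by simp
      then show "sqrt (1 + g\<^sup>2) \<le> 1 + g\<^sup>2" by (intro real_le_lsqrt) auto
    qed
    have gL: "g\<^sup>2 \<le> (M * (L + 1))\<^sup>2"
    proof -
      have "M * (\<bar>s\<bar> + u) \<le> M * (L + 1)" using s u M by (intro mult_left_mono) auto
      then have "\<bar>g\<bar> \<le> M * (L + 1)" using g by simp
      then show ?thesis by (metis abs_ge_zero power2_abs power_mono)
    qed
    have g2: "g\<^sup>2 \<le> 2 * M\<^sup>2 * (u * q)"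
    proof -
      have "\<bar>g\<bar>\<^sup>2 \<le> (M * (\<bar>s\<bar> + u))\<^sup>2" using g by (intro power_mono) auto
      also have "\<dots> = M\<^sup>2 * (\<bar>s\<bar> + u)\<^sup>2" by (simp add: power_mult_distrib)
      also have "(\<bar>s\<bar> + u)\<^sup>2 \<le> 2 * (s\<^sup>2 + u\<^sup>2)"
        using zero_le_power2[of "\<bar>s\<bar> - u"] by (simp add: power2_eq_square algebra_simps)
      also have "u\<^sup>2 \<le> u" using u by (simp add: power2_eq_square mult_left_le)
      finally have "\<bar>g\<bar>\<^sup>2 \<le> M\<^sup>2 * (2 * (s\<^sup>2 + u))" by (simp add: mult_left_mono)
      then show ?thesis unfolding uq by (simp add: mult_ac)
    qed
    have H3: "\<bar>H\<bar> \<le> C3"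
    proof -
      have "\<bar>H\<bar> = \<bar>a\<bar> * sqrt (1 + g\<^sup>2)" using sqrt1 by (simp add: H_def abs_mult)
      also have "\<dots> \<le> M * (1 + (M * (L + 1))\<^sup>2)" using a sqrt1 gL M by (intro mult_mono) auto
      finally show ?thesis by (simp add: C3_def)
    qed
    have H4: "\<bar>H - a0 - a1 * s\<bar> \<le> C4 * t * q"
    proof -
      have "\<bar>H - a\<bar> = \<bar>a\<bar> * (sqrt (1 + g\<^sup>2) - 1)"
      proof -
        have "H - a = a * (sqrt (1 + g\<^sup>2) - 1)" by (simp add: H_def algebra_simps)
        then show ?thesis using sqrt1 by (simp add: abs_mult)
      qed
      also have "\<dots> \<le> M * (2 * M\<^sup>2 * (u * q))" using a sqrt1 g2 M by (intro mult_mono) auto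
      finally have "\<bar>H - a\<bar> \<le> M * (2 * M\<^sup>2 * (u * q))" .
      then have "\<bar>H - a0 - a1 * s\<bar> \<le> M * (2 * M\<^sup>2 * (u * q)) + M * (u * q)" using a(4) uq by auto
      also have "\<dots> = C4 * (u * q)" by (simp add: C4_def algebra_simps)
      also have "\<dots> \<le> C4 * (t * q)" using C0 u q1 by (intro mult_left_mono mult_right_mono) auto
      finally show ?thesis by (simp add: mult_ac)
    qed
    \<comment> \<open>The product of the two expansions; the cross term \<open>z0 * (a1 * s)\<close> is already an error term.\<close>
    have "exp z * H - (a0 * (1 + z0) + a1 * s)
        = (exp z - 1 - z0) * H + (1 + z0) * (H - a0 - a1 * s) + z0 * (a1 * s)"
      by (simp add: algebra_simps)
    then have "\<bar>exp z * H - (a0 * (1 + z0) + a1 * s)\<bar>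
        \<le> \<bar>exp z - 1 - z0\<bar> * \<bar>H\<bar> + \<bar>1 + z0\<bar> * \<bar>H - a0 - a1 * s\<bar> + \<bar>z0\<bar> * \<bar>a1 * s\<bar>"
      using abs_triangle_ineq[of "(exp z - 1 - z0) * H + (1 + z0) * (H - a0 - a1 * s)" "z0 * (a1 * s)"]
        abs_triangle_ineq[of "(exp z - 1 - z0) * H" "(1 + z0) * (H - a0 - a1 * s)"]
      by (simp only: abs_mult)
    also have "\<dots> \<le> (C2\<^sup>2 + C1) * X * C3 + ((1 + \<bar>c\<bar> * M) * C4) * X + (\<bar>c\<bar> * M * M) * X"
    proof (intro add_mono)
      show "\<bar>exp z - 1 - z0\<bar> * \<bar>H\<bar> \<le> (C2\<^sup>2 + C1) * X * C3"
        using eX H3 X0 C0 by (intro mult_mono) auto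
      have "\<bar>1 + z0\<bar> \<le> 1 + \<bar>c\<bar> * M * \<theta> * q" using z0 by linarith
      also have "\<dots> \<le> q + \<bar>c\<bar> * M * 1 * q" using \<theta> q1 M by (intro add_mono mult_left_mono mult_right_mono) auto
      also have "\<dots> = (1 + \<bar>c\<bar> * M) * q" by (simp add: algebra_simps)
      finally have "\<bar>1 + z0\<bar> * \<bar>H - a0 - a1 * s\<bar> \<le> ((1 + \<bar>c\<bar> * M) * q) * (C4 * t * q)"
        using H4 M q1 by (intro mult_mono) auto
      also have "\<dots> = ((1 + \<bar>c\<bar> * M) * C4) * t * q\<^sup>2" by (simp add: power2_eq_square mult_ac)
      also have "\<dots> \<le> ((1 + \<bar>c\<bar> * M) * C4) * X" by (rule pX[OF nn(1) zero_le_power2 q4(3)])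
      finally show "\<bar>1 + z0\<bar> * \<bar>H - a0 - a1 * s\<bar> \<le> ((1 + \<bar>c\<bar> * M) * C4) * X" .
      have "\<rho> * q \<le> \<theta> * q" using \<theta> q1 by (intro mult_right_mono) auto
      then have "\<bar>s\<bar> \<le> \<theta> * q" using sq by linarith
      then have "\<bar>a1 * s\<bar> \<le> M * (\<theta> * q)"
        unfolding abs_mult by (rule mult_mono[OF a(3) _ M abs_ge_zero])
      then have "\<bar>z0\<bar> * \<bar>a1 * s\<bar> \<le> (\<bar>c\<bar> * M * \<theta> * q) * (M * (\<theta> * q))"
        by (rule mult_mono[OF z0 _ nn(3) abs_ge_zero])
      also have "\<dots> = (\<bar>c\<bar> * M * M) * t * q\<^sup>2" unfolding \<theta>(2)[symmetric] by (simp add: power2_eq_square)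
      also have "\<dots> \<le> (\<bar>c\<bar> * M * M) * X" by (rule pX[OF nn(2) zero_le_power2 q4(3)])
      finally show "\<bar>z0\<bar> * \<bar>a1 * s\<bar> \<le> (\<bar>c\<bar> * M * M) * X" .
    qed
    also have "\<dots> = C * X" by (simp add: C_def algebra_simps)
    finally have main: "\<bar>exp z * H - (a0 * (1 + z0) + a1 * s)\<bar> \<le> C * X" .
    have z0': "z0 = c * sqrt t * (\<kappa> * s\<^sup>2 / (4 * u) - v / 2)"
      using u by (simp add: z0_def d0_def \<theta>_def field_simps)
    have CX: "C * X = C * t * ((1 + s\<^sup>2 / u) ^ 4 * exp ((1 + s\<^sup>2 / u) / 8))"
      by (simp add: X_def q_def)
    show ?thesis
      using main unfolding z0' CX z_def H_def \<theta>_def d_def g_def a_def .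
  qed
  show ?thesis
    apply (rule that[OF C0(5)])
    subgoal premises p for t u s y g a a0 a1 \<kappa> v by (rule *[OF p])
    done
qed

text \<open>
  These are the moments of the centred normal distribution of variance \<open>2 u\<close>.
\<close>

lemma gaussian_has_integral:
  fixes a b e u :: real
  assumes "0 < u"
  shows "((\<lambda>s. exp (- s\<^sup>2 / (4 * u)) * (a + b * s + e * s\<^sup>2)) has_integral sqrt (4 * pi * u) * (a + 2 * u * e)) UNIV"
proof -
  define \<sigma> where "\<sigma> = sqrt (2 * u)"
  have \<sigma>: "0 < \<sigma>" "\<sigma>\<^sup>2 = 2 * u" using assms by (auto simp: \<sigma>_def)
  have nd: "normal_density 0 \<sigma> s = exp (- s\<^sup>2 / (4 * u)) / sqrt (4 * pi * u)" for s
    by (simp add: normal_density_def \<sigma>(2) algebra_simps)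
  note m0 = normal_moment_even[OF \<sigma>(1), where k = 0 and \<mu> = 0]
  note m1 = normal_moment_odd[OF \<sigma>(1), where k = 0 and \<mu> = 0]
  note m2 = normal_moment_even[OF \<sigma>(1), where k = 1 and \<mu> = 0]
  define D where "D = sqrt (4 * pi * u)"
  have D: "0 < D" using assms by (simp add: D_def)
  have "has_bochner_integral lborel
     (\<lambda>s. (a * D) * (normal_density 0 \<sigma> s * (s - 0) ^ (2 * 0)) +
       (b * D) * (normal_density 0 \<sigma> s * (s - 0) ^ (2 * 0 + 1)) +
       (e * D) * (normal_density 0 \<sigma> s * (s - 0) ^ (2 * 1)))
     ((a * D) * (fact (2 * 0) / ((2 / \<sigma>\<^sup>2) ^ 0 * fact 0)) + (b * D) * 0 +
      (e * D) * (fact (2 * 1) / ((2 / \<sigma>\<^sup>2) ^ 1 * fact 1)))"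
    by (intro has_bochner_integral_add has_bochner_integral_mult_right m0 m1 m2)
  also have "(\<lambda>s. (a * D) * (normal_density 0 \<sigma> s * (s - 0) ^ (2 * 0)) +
       (b * D) * (normal_density 0 \<sigma> s * (s - 0) ^ (2 * 0 + 1)) +
       (e * D) * (normal_density 0 \<sigma> s * (s - 0) ^ (2 * 1)))
     = (\<lambda>s. exp (- s\<^sup>2 / (4 * u)) * (a + b * s + e * s\<^sup>2))"
    unfolding nd D_def[symmetric] using D by (auto simp: field_simps power2_eq_square)
  also have "(a * D) * (fact (2 * 0) / ((2 / \<sigma>\<^sup>2) ^ 0 * fact 0)) + (b * D) * 0 +
      (e * D) * (fact (2 * 1) / ((2 / \<sigma>\<^sup>2) ^ 1 * fact 1)) = D * (a + 2 * u * e)"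
    using \<sigma> by (simp add: algebra_simps)
  finally have *: "has_bochner_integral lborel (\<lambda>s. exp (- s\<^sup>2 / (4 * u)) * (a + b * s + e * s\<^sup>2)) (D * (a + 2 * u * e))" .
  show ?thesis
    using has_integral_integral_lborel[OF integrable.intros[OF *]]
    unfolding has_bochner_integral_integral_eq[OF *] D_def .
qed

text \<open>
  Half of the Gaussian decay left over after \<open>exp (q / 8)\<close>, namely \<open>exp (- q / 16)\<close>, absorbs the polynomial, because
  \<open>q / 64 \<le> exp (q / 64)\<close>.
\<close>

lemma polynomial_absorbed_by_gaussian:
  fixes q :: real
  assumes "1 \<le> q"
  shows "q ^ 4 * exp (q / 8) * exp (- (q - 1) / 4) \<le> 64 ^ 4 * exp 1 * exp (- (q - 1) / 16)"
proof -
  have "q / 64 \<le> exp (q / 64)" using exp_ge_add_one_self[of "q / 64"] by linarith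
  then have "(q / 64) ^ 4 \<le> exp (q / 64) ^ 4" using assms by (intro power_mono) auto
  also have "\<dots> = exp (q / 16)" by (simp add: exp_of_nat_mult[symmetric])
  finally have "q ^ 4 \<le> 64 ^ 4 * exp (q / 16)" by (simp add: field_simps)
  then have "q ^ 4 * exp (q / 8) * exp (- (q - 1) / 4) \<le> 64 ^ 4 * exp (q / 16) * exp (q / 8) * exp (- (q - 1) / 4)"
    by (intro mult_right_mono) auto
  also have "\<dots> = 64 ^ 4 * exp (q / 16 + q / 8 + (- (q - 1) / 4))" by (simp only: exp_add mult.assoc)
  also have "\<dots> \<le> 64 ^ 4 * exp (1 + - (q - 1) / 16)" by (simp add: field_simps)
  finally show ?thesis by (simp only: exp_add mult.assoc)
qed

text \<open>
  Integration of the local expansion against the Gaussian.  The main term is integrated over the whole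
  line; outside \<open>(-L, L)\<close> it is itself an admissible error, as there \<open>1 \<le> s\<^sup>2 / L\<^sup>2 \<le> t q / L\<^sup>2\<close>.  The common
  error bound \<open>t exp (- s\<^sup>2 / 16u)\<close> integrates to a multiple of \<open>t sqrt u\<close>, and the prefactor \<open>1 / (4 pi u)\<close> of the heat
  kernel turns this into \<open>t / sqrt u\<close>.
\<close>

lemma graph_potential_expansion:
  fixes M L c :: real
  assumes M: "0 \<le> M" and L: "0 < L"
  obtains C where "0 \<le> C" and "\<And>t u y g a a0 a1 \<kappa> v.
    \<lbrakk>0 < u; u \<le> t; t \<le> 1; 4 * \<bar>c\<bar> * (M * (3 + L)) * sqrt t \<le> 1;
     second_order_contact M L u \<kappa> v a0 a1 y g a;
     (\<lambda>s. exp (- (s\<^sup>2 + (c * sqrt t - y s)\<^sup>2) / (4 * u)) * (a s * sqrt (1 + (g s)\<^sup>2)))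
       integrable_on {-L<..<L}\<rbrakk> \<Longrightarrow>
    \<bar>1 / (4 * pi * u) * integral {-L<..<L}
        (\<lambda>s. exp (- (s\<^sup>2 + (c * sqrt t - y s)\<^sup>2) / (4 * u)) * (a s * sqrt (1 + (g s)\<^sup>2)))
      - exp (- (c * sqrt t)\<^sup>2 / (4 * u)) / sqrt (4 * pi * u) * (a0 * (1 + (\<kappa> - v) / 2 * (c * sqrt t)))\<bar>
    \<le> C * t / sqrt (4 * pi * u)"
proof -
  obtain C1 where C1: "0 \<le> C1" and loc: "\<And>t u s y g a a0 a1 \<kappa> v.
    \<lbrakk>0 < u; u \<le> t; t \<le> 1; 4 * \<bar>c\<bar> * (M * (3 + L)) * sqrt t \<le> 1;
     second_order_contact M L u \<kappa> v a0 a1 y g a; s \<in> {-L<..<L}\<rbrakk> \<Longrightarrow>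
    \<bar>exp ((2 * (c * sqrt t) * y s - (y s)\<^sup>2) / (4 * u)) * (a s * sqrt (1 + (g s)\<^sup>2))
      - (a0 * (1 + c * sqrt t * (\<kappa> * s\<^sup>2 / (4 * u) - v / 2)) + a1 * s)\<bar>
    \<le> C1 * t * ((1 + s\<^sup>2 / u) ^ 4 * exp ((1 + s\<^sup>2 / u) / 8))"
    by (fact local_expansion[OF M L])
  define C2 where "C2 = M * (2 + \<bar>c\<bar> * M) / L\<^sup>2"
  define C3 where "C3 = max C1 C2"
  define C where "C = C3 * (64 ^ 4 * exp 1) * 2"
  have C2: "0 \<le> C2" using M L by (simp add: C2_def)
  have C3: "0 \<le> C3" "C1 \<le> C3" "C2 \<le> C3" using C1 by (auto simp: C3_def)
  have C: "0 \<le> C" using C3 by (simp add: C_def)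
  have *: "\<bar>1 / (4 * pi * u) * integral {-L<..<L} (\<lambda>s. exp (- (s\<^sup>2 + (c * sqrt t - y s)\<^sup>2) / (4 * u)) * (a s * sqrt (1 + (g s)\<^sup>2)))
      - exp (- (c * sqrt t)\<^sup>2 / (4 * u)) / sqrt (4 * pi * u) * (a0 * (1 + (\<kappa> - v) / 2 * (c * sqrt t)))\<bar>
    \<le> C * t / sqrt (4 * pi * u)"
    if u: "0 < u" "u \<le> t" "t \<le> 1" and small: "4 * \<bar>c\<bar> * (M * (3 + L)) * sqrt t \<le> 1"
      and contact: "second_order_contact M L u \<kappa> v a0 a1 y g a"
      and int: "(\<lambda>s. exp (- (s\<^sup>2 + (c * sqrt t - y s)\<^sup>2) / (4 * u)) * (a s * sqrt (1 + (g s)\<^sup>2))) integrable_on {-L<..<L}"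
    for t u a0 a1 \<kappa> v :: real and y g a :: "real \<Rightarrow> real"
  proof -
    have kv: "\<bar>\<kappa>\<bar> \<le> M" "\<bar>v\<bar> \<le> M" "\<bar>a0\<bar> \<le> M" "\<bar>a1\<bar> \<le> M"
      using contact by (auto simp: second_order_contact_def)
    define h where "h = c * sqrt t"
    define f where "f = (\<lambda>s. exp (- (s\<^sup>2 + (h - y s)\<^sup>2) / (4 * u)) * (a s * sqrt (1 + (g s)\<^sup>2)))"
    define E where "E = exp (- h\<^sup>2 / (4 * u))"
    define p where "p = (\<lambda>s. a0 * (1 + h * (\<kappa> * s\<^sup>2 / (4 * u) - v / 2)) + a1 * s)"
    define F where "F = (\<lambda>s. if s \<in> {-L<..<L} then f s else 0)"
    have E: "0 < E" "E \<le> 1" using u by (auto simp: E_def)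
    have I1: "(F has_integral integral {-L<..<L} f) UNIV"
      unfolding F_def has_integral_restrict_UNIV using int by (intro integrable_integral) (simp only: f_def h_def)
    have I2: "((\<lambda>s. E * (exp (- s\<^sup>2 / (4 * u)) * p s)) has_integral
        E * (sqrt (4 * pi * u) * (a0 * (1 + (\<kappa> - v) / 2 * h)))) UNIV"
    proof (rule has_integral_mult_right)
      have p_eq: "p = (\<lambda>s. (a0 * (1 - h * v / 2)) + a1 * s + (a0 * h * \<kappa> / (4 * u)) * s\<^sup>2)"
        by (auto simp: p_def algebra_simps)
      have moment_eq: "a0 * (1 + (\<kappa> - v) / 2 * h) = (a0 * (1 - h * v / 2)) + 2 * u * (a0 * h * \<kappa> / (4 * u))"
        using u by (simp add: field_simps)
      show "((\<lambda>s. exp (- s\<^sup>2 / (4 * u)) * p s) has_integral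
         (sqrt (4 * pi * u) * (a0 * (1 + (\<kappa> - v) / 2 * h)))) UNIV"
        unfolding p_eq moment_eq by (rule gaussian_has_integral[OF u(1)])
    qed
    define Q where "Q = C3 * (64 ^ 4 * exp 1) * t"
    \<comment> \<open>The dominating function \<open>Q * exp (- s\<^sup>2 / 16u)\<close> is a Gaussian at time \<open>4 * u\<close>.\<close>
    have I3: "((\<lambda>s. exp (- s\<^sup>2 / (4 * (4 * u))) * (Q + 0 * s + 0 * s\<^sup>2)) has_integral
        sqrt (4 * pi * (4 * u)) * (Q + 2 * (4 * u) * 0)) UNIV"
      by (rule gaussian_has_integral) (use u in simp)
    have bound: "\<bar>F s - E * (exp (- s\<^sup>2 / (4 * u)) * p s)\<bar> \<le> exp (- s\<^sup>2 / (4 * (4 * u))) * (Q + 0 * s + 0 * s\<^sup>2)" for s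
    proof -
      define q where "q = 1 + s\<^sup>2 / u"
      have q: "1 \<le> q" "s\<^sup>2 / u = q - 1" using u by (auto simp: q_def)
      have e4: "exp (- s\<^sup>2 / (4 * u)) = exp (- (q - 1) / 4)" "exp (- s\<^sup>2 / (4 * (4 * u))) = exp (- (q - 1) / 16)"
        using u unfolding q(2)[symmetric] by (simp_all add: field_simps)
      have "\<bar>F s - E * (exp (- s\<^sup>2 / (4 * u)) * p s)\<bar> \<le> E * exp (- s\<^sup>2 / (4 * u)) * (C3 * t * (q ^ 4 * exp (q / 8)))"
      proof (cases "s \<in> {-L<..<L}")
        case True
        have "F s = E * exp (- s\<^sup>2 / (4 * u)) * (exp ((2 * h * y s - (y s)\<^sup>2) / (4 * u)) * (a s * sqrt (1 + (g s)\<^sup>2)))"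
        proof -
          have "- (s\<^sup>2 + (h - y s)\<^sup>2) / (4 * u) = - h\<^sup>2 / (4 * u) + - s\<^sup>2 / (4 * u) + (2 * h * y s - (y s)\<^sup>2) / (4 * u)"
            using u by (simp add: field_simps power2_eq_square)
          then have "exp (- (s\<^sup>2 + (h - y s)\<^sup>2) / (4 * u)) = E * exp (- s\<^sup>2 / (4 * u)) * exp ((2 * h * y s - (y s)\<^sup>2) / (4 * u))"
            unfolding E_def by (simp only: exp_add)
          then show ?thesis using True by (simp add: F_def f_def)
        qed
        then have "F s - E * (exp (- s\<^sup>2 / (4 * u)) * p s) = E * exp (- s\<^sup>2 / (4 * u)) *
            (exp ((2 * h * y s - (y s)\<^sup>2) / (4 * u)) * (a s * sqrt (1 + (g s)\<^sup>2)) - p s)"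
          by (simp add: algebra_simps)
        then have "\<bar>F s - E * (exp (- s\<^sup>2 / (4 * u)) * p s)\<bar> = E * exp (- s\<^sup>2 / (4 * u)) *
            \<bar>exp ((2 * h * y s - (y s)\<^sup>2) / (4 * u)) * (a s * sqrt (1 + (g s)\<^sup>2)) - p s\<bar>"
          using E by (simp add: abs_mult)
        also have "\<dots> \<le> E * exp (- s\<^sup>2 / (4 * u)) * (C1 * t * (q ^ 4 * exp (q / 8)))"
          unfolding p_def h_def q_def using E True u small
          by (intro mult_left_mono loc[OF _ _ _ _ contact]) auto
        also have "\<dots> \<le> E * exp (- s\<^sup>2 / (4 * u)) * (C3 * t * (q ^ 4 * exp (q / 8)))"
          using E u q C3 by (intro mult_left_mono mult_right_mono) auto
        finally show ?thesis .
      next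
        case False
        have sL: "L\<^sup>2 \<le> s\<^sup>2" using False L by (auto simp: abs_le_square_iff[symmetric])
        have h: "\<bar>h\<bar> \<le> \<bar>c\<bar>" using u by (simp add: h_def abs_mult mult_left_le)
        have sq: "\<bar>s\<bar> \<le> q"
        proof -
          have "s\<^sup>2 = u * (q - 1)" using u q by (simp add: field_simps)
          also have "\<dots> \<le> 1 * (q - 1)" using u q by (intro mult_right_mono) auto
          also have "\<dots> \<le> q\<^sup>2" using self_le_power[of q 2] q by simp
          finally show ?thesis using q by (metis abs_le_square_iff abs_of_nonneg order_trans zero_le_one)
        qed
        define \<zeta> where "\<zeta> = h * (\<kappa> * ((q - 1) / 4) - v / 2)"
        have "\<bar>\<kappa> * ((q - 1) / 4) - v / 2\<bar> \<le> \<bar>\<kappa> * ((q - 1) / 4)\<bar> + \<bar>v / 2\<bar>"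
          by (rule abs_triangle_ineq4)
        also have "\<dots> = \<bar>\<kappa>\<bar> * ((q - 1) / 4) + \<bar>v\<bar> / 2" using q by (simp add: abs_mult)
        also have "\<dots> \<le> M * ((q - 1) / 4) + M / 2"
          using kv q by (intro add_mono mult_right_mono divide_right_mono) auto
        also have "\<dots> = M * ((q - 1) / 4 + 1 / 2)" by (simp add: distrib_left)
        also have "\<dots> \<le> M * q" using M q(1) by (intro mult_left_mono) (simp_all add: field_simps)
        finally have "\<bar>\<zeta>\<bar> \<le> \<bar>c\<bar> * (M * q)"
          unfolding \<zeta>_def abs_mult[of h] by (rule mult_mono[OF h _ abs_ge_zero abs_ge_zero])
        then have "\<bar>1 + \<zeta>\<bar> \<le> q + \<bar>c\<bar> * (M * q)" using q by linarith
        then have "\<bar>a0\<bar> * \<bar>1 + \<zeta>\<bar> \<le> M * (q + \<bar>c\<bar> * (M * q))"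
          by (rule mult_mono[OF kv(3) _ M abs_ge_zero])
        moreover have "\<bar>a1\<bar> * \<bar>s\<bar> \<le> M * q"
          by (rule mult_mono[OF kv(4) sq M abs_ge_zero])
        moreover have "\<bar>p s\<bar> \<le> \<bar>a0\<bar> * \<bar>1 + \<zeta>\<bar> + \<bar>a1\<bar> * \<bar>s\<bar>"
        proof -
          have "\<kappa> * s\<^sup>2 / (4 * u) = \<kappa> * ((q - 1) / 4)" unfolding q(2)[symmetric] by simp
          then have "p s = a0 * (1 + \<zeta>) + a1 * s" by (simp only: p_def \<zeta>_def)
          then show ?thesis using abs_triangle_ineq[of "a0 * (1 + \<zeta>)" "a1 * s"] by (simp only: abs_mult)
        qed
        ultimately have "\<bar>p s\<bar> \<le> M * (q + \<bar>c\<bar> * (M * q)) + M * q" by linarith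
        also have "\<dots> = M * (2 + \<bar>c\<bar> * M) * q" by (simp add: algebra_simps)
        finally have ps: "\<bar>p s\<bar> \<le> M * (2 + \<bar>c\<bar> * M) * q" .
        \<comment> \<open>The factor \<open>t\<close> is gained from the distance to the origin.\<close>
        have "1 \<le> t * q / L\<^sup>2"
        proof -
          have "L\<^sup>2 \<le> u * (q - 1)" using sL u q by (simp add: field_simps)
          also have "\<dots> \<le> t * q" using u q by (intro mult_mono) auto
          finally show ?thesis using L by simp
        qed
        then have "M * (2 + \<bar>c\<bar> * M) * q * 1 \<le> M * (2 + \<bar>c\<bar> * M) * q * (t * q / L\<^sup>2)"
          using M q by (intro mult_left_mono) auto
        also have "\<dots> = C2 * t * q\<^sup>2" by (simp add: C2_def power2_eq_square)
        also have "\<dots> \<le> C3 * t * (q ^ 4 * exp (q / 8))"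
        proof -
          have "q\<^sup>2 * 1 \<le> q ^ 4 * exp (q / 8)" using q by (intro mult_mono power_increasing) auto
          then show ?thesis using C3 C2 u by (intro mult_mono) auto
        qed
        finally have "\<bar>p s\<bar> \<le> C3 * t * (q ^ 4 * exp (q / 8))" using ps by linarith
        moreover have "\<bar>F s - E * (exp (- s\<^sup>2 / (4 * u)) * p s)\<bar> = E * exp (- s\<^sup>2 / (4 * u)) * \<bar>p s\<bar>"
        proof -
          have "F s = 0" unfolding F_def using False by (rule if_not_P)
          then show ?thesis using E by (simp add: abs_mult)
        qed
        ultimately show ?thesis using E by (metis exp_ge_zero less_imp_le mult_left_mono mult_nonneg_nonneg)
      qed
      also have "\<dots> \<le> 1 * exp (- s\<^sup>2 / (4 * u)) * (C3 * t * (q ^ 4 * exp (q / 8)))"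
        using E C3 u q by (intro mult_right_mono) auto
      also have "\<dots> = C3 * t * (q ^ 4 * exp (q / 8) * exp (- (q - 1) / 4))" unfolding e4 by simp
      also have "\<dots> \<le> C3 * t * (64 ^ 4 * exp 1 * exp (- (q - 1) / 16))"
        using C3 u polynomial_absorbed_by_gaussian[OF q(1)] by (intro mult_left_mono) auto
      finally show ?thesis unfolding e4 Q_def by (simp add: mult_ac)
    qed
    define D where "D = sqrt (4 * pi * u)"
    have D: "0 < D" "4 * pi * u = D * D" using u by (simp_all add: D_def)
    have D4: "sqrt (4 * pi * (4 * u)) * (Q + 2 * (4 * u) * 0) = D * (2 * Q)"
    proof -
      have "4 * pi * (4 * u) = 4 * (4 * pi * u)" by simp
      then show ?thesis by (simp only: real_sqrt_mult[of 4 "4 * pi * u"] D_def[symmetric]) simp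
    qed
    have *: "\<bar>integral {-L<..<L} f - E * (D * (a0 * (1 + (\<kappa> - v) / 2 * h)))\<bar> \<le> D * (2 * Q)"
    proof -
      note J = has_integral_diff[OF I1 I2]
      have "norm (integral UNIV (\<lambda>s. F s - E * (exp (- s\<^sup>2 / (4 * u)) * p s)))
          \<le> integral UNIV (\<lambda>s. exp (- s\<^sup>2 / (4 * (4 * u))) * (Q + 0 * s + 0 * s\<^sup>2))"
        by (rule integral_norm_bound_integral[OF has_integral_integrable[OF J] has_integral_integrable[OF I3]])
          (simp only: real_norm_def bound)
      then show ?thesis by (simp only: integral_unique[OF J] integral_unique[OF I3] real_norm_def D4 D_def[symmetric])
    qed
    have "1 / (4 * pi * u) * integral {-L<..<L} f - E / D * (a0 * (1 + (\<kappa> - v) / 2 * h))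
       = (integral {-L<..<L} f - E * (D * (a0 * (1 + (\<kappa> - v) / 2 * h)))) / (D * D)"
    proof -
      have "1 / (D * D) * I - E / D * Z = (I - E * (D * Z)) / (D * D)" for I Z
        using D(1) by (simp add: diff_divide_distrib)
      then show ?thesis unfolding D(2) .
    qed
    then have "\<bar>1 / (4 * pi * u) * integral {-L<..<L} f - E / D * (a0 * (1 + (\<kappa> - v) / 2 * h))\<bar>
        = \<bar>integral {-L<..<L} f - E * (D * (a0 * (1 + (\<kappa> - v) / 2 * h)))\<bar> / (D * D)"
      using D(1) by (simp only: abs_divide abs_of_pos[OF mult_pos_pos[OF D(1) D(1)]])
    also have "\<dots> \<le> D * (2 * Q) / (D * D)" using * D(1) by (intro divide_right_mono) auto
    also have "\<dots> = C * t / D" using D(1) by (simp add: Q_def C_def)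
    finally show ?thesis unfolding f_def h_def E_def D_def .
  qed
  show ?thesis
    apply (rule that[OF C])
    subgoal premises p for t u y g a a0 a1 \<kappa> v
      by (rule *[where u = u and t = t and y = y and g = g and a = a, OF p])
    done
qed

section \<open>The time integral and the exponential integral\<close>

text \<open>
  The substitution is \<open>\<tau> = t - t / z\<close>, which maps \<open>z \<ge> 1\<close> onto \<open>[0, t)\<close> and turns \<open>(c sqrt t)\<^sup>2 / (4 (t - \<tau>))\<close> into
  \<open>c\<^sup>2 z / 4\<close>.  For \<open>c = 0\<close> the same formula integrates the error bound \<open>1 / sqrt (4 pi (t - \<tau>))\<close>.
\<close>

lemma exp_integral_as_time_integral:
  fixes c t :: real
  assumes t: "0 < t"
  shows "((\<lambda>\<tau>. exp (- (c * sqrt t)\<^sup>2 / (4 * (t - \<tau>))) / sqrt (4 * pi * (t - \<tau>)))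
    has_integral 1 / 2 * sqrt (t / pi) * exp_integral (3 / 2) (c\<^sup>2 / 4)) {0..t}"
proof -
  define f where "f = (\<lambda>\<tau>. exp (- (c * sqrt t)\<^sup>2 / (4 * (t - \<tau>))) / sqrt (4 * pi * (t - \<tau>)))"
  define g where "g = (\<lambda>z::real. t - t / z)"
  define g' where "g' = (\<lambda>z::real. t / z\<^sup>2)"
  define k where "k = (\<lambda>z::real. z powr (- (3 / 2)) * exp (- (c\<^sup>2 / 4) * z))"
  have k: "k absolutely_integrable_on {1..}"
  proof (rule measurable_bounded_by_integrable_imp_absolutely_integrable)
    have "continuous_on {1..} k" unfolding k_def by (intro continuous_intros) auto
    then show "k \<in> borel_measurable (lebesgue_on {1..})"
      by (intro continuous_imp_measurable_on_sets_lebesgue) auto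
    show "(\<lambda>z::real. z powr (- (3 / 2))) integrable_on {1..}"
      using has_integral_powr_to_inf[of "- (3 / 2)" 1] by (auto simp: integrable_on_def)
    show "norm (k z) \<le> z powr (- (3 / 2))" if "z \<in> {1..}" for z
      using that by (auto simp: k_def abs_mult intro!: mult_left_le)
  qed auto
  have pull: "\<bar>g' z\<bar> * f (g z) = 1 / 2 * sqrt (t / pi) * k z" if "z \<in> {1..}" for z
  proof -
    have z: "0 < z" using that by auto
    have "(c * sqrt t)\<^sup>2 / (4 * (t / z)) = (c\<^sup>2 / 4) * z" using t z by (simp add: power_mult_distrib field_simps)
    then have "f (g z) = exp (- (c\<^sup>2 / 4) * z) / sqrt (4 * pi * (t / z))" by (simp add: f_def g_def)
    also have "sqrt (4 * pi * (t / z)) = 2 * sqrt pi * sqrt t / sqrt z"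
      by (simp add: real_sqrt_mult real_sqrt_divide)
    finally have fg: "f (g z) = exp (- (c\<^sup>2 / 4) * z) * sqrt z / (2 * sqrt pi * sqrt t)" by simp
    have "z powr (- (3 / 2)) = z powr (1 / 2 - 2)" by simp
    also have "\<dots> = sqrt z / z\<^sup>2" using z by (subst powr_diff) (simp add: powr_half_sqrt)
    finally have zp: "z powr (- (3 / 2)) = sqrt z / z\<^sup>2" .
    have "t = sqrt t * sqrt t" using t by simp
    then have "t / (2 * sqrt pi * sqrt t) = 1 / 2 * sqrt (t / pi)"
      using t by (simp add: real_sqrt_divide field_simps)
    moreover have "\<bar>g' z\<bar> * f (g z) = t / (2 * sqrt pi * sqrt t) * (sqrt z / z\<^sup>2 * exp (- (c\<^sup>2 / 4) * z))"
      unfolding fg g'_def using t by (simp add: mult_ac)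
    ultimately show ?thesis by (simp only: k_def zp)
  qed
  have img: "g ` {1..} = {0..<t}"
  proof
    show "g ` {1..} \<subseteq> {0..<t}" using t by (auto simp: g_def field_simps)
    show "{0..<t} \<subseteq> g ` {1..}"
    proof
      fix \<tau> assume "\<tau> \<in> {0..<t}"
      then have "\<tau> = g (t / (t - \<tau>))" "t / (t - \<tau>) \<in> {1..}" using t by (auto simp: g_def field_simps)
      then show "\<tau> \<in> g ` {1..}" by blast
    qed
  qed
  have deriv: "(g has_field_derivative g' z) (at z within {1..})" if "z \<in> {1..}" for z
    unfolding g_def g'_def using that by (auto intro!: derivative_eq_intros simp: power2_eq_square)
  have inj: "inj_on g {1..}" using t by (auto simp: inj_on_def g_def)
  have "(\<lambda>z. 1 / 2 * sqrt (t / pi) * k z) absolutely_integrable_on {1..}"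
    by (rule absolutely_integrable_scaleR_left[OF k, of "1 / 2 * sqrt (t / pi)", unfolded real_scaleR_def])
  moreover have "(\<lambda>z. \<bar>g' z\<bar> * f (g z)) absolutely_integrable_on {1..} \<longleftrightarrow>
      (\<lambda>z. 1 / 2 * sqrt (t / pi) * k z) absolutely_integrable_on {1..}"
    by (rule set_integrable_cong) (auto simp: pull)
  moreover have "integral {1..} (\<lambda>z. \<bar>g' z\<bar> * f (g z)) = integral {1..} (\<lambda>z. 1 / 2 * sqrt (t / pi) * k z)"
    by (rule integral_cong) (auto simp: pull)
  moreover have "integral {1..} (\<lambda>z. 1 / 2 * sqrt (t / pi) * k z) = 1 / 2 * sqrt (t / pi) * exp_integral (3 / 2) (c\<^sup>2 / 4)"
    by (simp add: exp_integral_def k_def)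
  ultimately have "(\<lambda>z. \<bar>g' z\<bar> * f (g z)) absolutely_integrable_on {1..} \<and>
      integral {1..} (\<lambda>z. \<bar>g' z\<bar> * f (g z)) = 1 / 2 * sqrt (t / pi) * exp_integral (3 / 2) (c\<^sup>2 / 4)"
    by (intro conjI) (simp_all only:)
  then have "f absolutely_integrable_on {0..<t} \<and>
      integral {0..<t} f = 1 / 2 * sqrt (t / pi) * exp_integral (3 / 2) (c\<^sup>2 / 4)"
    unfolding img[symmetric]
    by (subst has_absolute_integral_change_of_variables_1'[OF _ deriv inj, symmetric]) auto
  then have "(f has_integral 1 / 2 * sqrt (t / pi) * exp_integral (3 / 2) (c\<^sup>2 / 4)) {0..<t}"
    by (simp add: has_integral_iff set_lebesgue_integral_eq_integral(1))
  then have "(f has_integral 1 / 2 * sqrt (t / pi) * exp_integral (3 / 2) (c\<^sup>2 / 4)) {0..t}"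
    by (subst (asm) has_integral_spike_set_eq[of _ "{0..t}"]) (auto intro: negligible_subset[of "{t}"])
  then show ?thesis unfolding f_def .
qed

text \<open>
  The endpoint \<open>\<tau> = t\<close>, where the kernel is singular, is a null set; on \<open>[0, t)\<close> the function \<open>\<Phi>\<close> is continuous and
  dominated by an integrable function, which provides its integrability.
\<close>

lemma time_integral_estimate:
  fixes \<Phi> :: "real \<Rightarrow> real"
  assumes t: "0 < t" and cont: "continuous_on {0..<t} \<Phi>"
    and est: "\<And>\<tau>. \<tau> \<in> {0..<t} \<Longrightarrow>
      \<bar>\<Phi> \<tau> - exp (- (c * sqrt t)\<^sup>2 / (4 * (t - \<tau>))) / sqrt (4 * pi * (t - \<tau>)) * W\<bar> \<le> K / sqrt (4 * pi * (t - \<tau>))"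
  shows "\<bar>integral {0..t} \<Phi> - 1 / 2 * sqrt (t / pi) * exp_integral (3 / 2) (c\<^sup>2 / 4) * W\<bar>
    \<le> 1 / 2 * sqrt (t / pi) * exp_integral (3 / 2) 0 * K"
proof -
  define k where "k = (\<lambda>c \<tau>. exp (- (c * sqrt t)\<^sup>2 / (4 * (t - \<tau>))) / sqrt (4 * pi * (t - \<tau>)))"
  have spike: "(f has_integral I) {0..t} \<longleftrightarrow> (f has_integral I) {0..<t}" for f :: "real \<Rightarrow> real" and I
    by (rule has_integral_spike_set_eq) (auto intro: negligible_subset[of "{t}"])
  have k: "(k c has_integral 1 / 2 * sqrt (t / pi) * exp_integral (3 / 2) (c\<^sup>2 / 4)) {0..<t}" for c
    unfolding spike[symmetric] k_def by (rule exp_integral_as_time_integral[OF t])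
  have k0: "k 0 \<tau> = 1 / sqrt (4 * pi * (t - \<tau>))" for \<tau> by (simp add: k_def)
  note kW = has_integral_mult_left[OF k[of c], of W]
  have kK: "((\<lambda>\<tau>. k 0 \<tau> * K) has_integral 1 / 2 * sqrt (t / pi) * exp_integral (3 / 2) 0 * K) {0..<t}"
  proof -
    have "(0::real)\<^sup>2 / 4 = 0" by simp
    then show ?thesis using has_integral_mult_left[OF k[of 0], of K] by (simp only:)
  qed
  have kpos: "0 \<le> k c \<tau>" if "\<tau> \<in> {0..<t}" for \<tau> using that by (simp add: k_def)
  have est': "\<bar>\<Phi> \<tau> - k c \<tau> * W\<bar> \<le> k 0 \<tau> * K" if "\<tau> \<in> {0..<t}" for \<tau>
    using est[OF that] unfolding k0 by (simp add: k_def)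
  have "\<Phi> integrable_on {0..<t}"
  proof (rule measurable_bounded_by_integrable_imp_integrable)
    show "\<Phi> \<in> borel_measurable (lebesgue_on {0..<t})"
      by (intro continuous_imp_measurable_on_sets_lebesgue cont) auto
    show "(\<lambda>\<tau>. k c \<tau> * \<bar>W\<bar> + k 0 \<tau> * K) integrable_on {0..<t}"
      by (intro integrable_add has_integral_integrable[OF kK] has_integral_integrable[OF has_integral_mult_left[OF k]])
    show "norm (\<Phi> \<tau>) \<le> k c \<tau> * \<bar>W\<bar> + k 0 \<tau> * K" if "\<tau> \<in> {0..<t}" for \<tau>
    proof -
      have "\<bar>k c \<tau> * W\<bar> = k c \<tau> * \<bar>W\<bar>" using kpos[OF that] by (simp add: abs_mult)
      then show ?thesis using est'[OF that] by simp
    qed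
  qed auto
  then have \<Phi>: "(\<Phi> has_integral integral {0..t} \<Phi>) {0..<t}"
    using spike by (metis integrable_integral integral_unique)
  have "norm (integral {0..<t} (\<lambda>\<tau>. \<Phi> \<tau> - k c \<tau> * W)) \<le> integral {0..<t} (\<lambda>\<tau>. k 0 \<tau> * K)"
    by (rule integral_norm_bound_integral[OF has_integral_integrable[OF has_integral_diff[OF \<Phi> kW]]
          has_integral_integrable[OF kK]]) (simp only: real_norm_def est')
  then show ?thesis
    by (simp only: integral_unique[OF has_integral_diff[OF \<Phi> kW]] integral_unique[OF kK] real_norm_def)
qed

section \<open>Arc length integrals near the graph\<close>

definition tangent :: "real^2 \<Rightarrow> real^2" where
  "tangent n = vector [n $ 2, - (n $ 1)]"

lemma inner_frame:
  assumes "norm n = 1"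
  shows "n \<bullet> n = 1" "tangent n \<bullet> tangent n = 1" "tangent n \<bullet> n = 0" "n \<bullet> tangent n = 0"
proof -
  have "n \<bullet> n = 1" using assms by (simp add: norm_eq_1)
  then show "n \<bullet> n = 1" "tangent n \<bullet> tangent n = 1" "tangent n \<bullet> n = 0" "n \<bullet> tangent n = 0"
    by (simp_all add: tangent_def inner_vec_def sum_2 algebra_simps)
qed

lemma frame_expansion:
  assumes "norm n = 1"
  shows "w = (w \<bullet> tangent n) *\<^sub>R tangent n + (w \<bullet> n) *\<^sub>R n"
proof -
  have n: "n $ 1 * n $ 1 + n $ 2 * n $ 2 = 1" using inner_frame(1)[OF assms] by (simp add: inner_vec_def sum_2)
  have "w $ 1 = w $ 1 * (n $ 1 * n $ 1 + n $ 2 * n $ 2)" "w $ 2 = w $ 2 * (n $ 1 * n $ 1 + n $ 2 * n $ 2)"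
    using n by simp_all
  then show ?thesis
    by (simp add: vec_eq_iff forall_2 tangent_def inner_vec_def sum_2 algebra_simps)
qed

lemma norm_frame:
  assumes "norm n = 1"
  shows "(norm (a *\<^sub>R tangent n + b *\<^sub>R n))\<^sup>2 = a\<^sup>2 + b\<^sup>2"
  unfolding power2_norm_eq_inner using inner_frame[OF assms]
  by (simp add: inner_add_left inner_add_right power2_eq_square)

lemma local_point_tangent: "local_point x0 n s r = x0 + s *\<^sub>R tangent n + r *\<^sub>R n"
  by (simp add: local_point_def tangent_def)

lemma local_point_eq_iff:
  assumes "norm n = 1"
  shows "q = local_point x0 n s r \<longleftrightarrow> (q - x0) \<bullet> tangent n = s \<and> (q - x0) \<bullet> n = r"
proof
  assume "q = local_point x0 n s r"
  then have "q - x0 = s *\<^sub>R tangent n + r *\<^sub>R n" by (simp add: local_point_tangent)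
  then show "(q - x0) \<bullet> tangent n = s \<and> (q - x0) \<bullet> n = r"
    using inner_frame[OF assms] by (simp add: inner_add_left)
next
  assume "(q - x0) \<bullet> tangent n = s \<and> (q - x0) \<bullet> n = r"
  then have "q - x0 = s *\<^sub>R tangent n + r *\<^sub>R n" using frame_expansion[OF assms, of "q - x0"] by simp
  then show "q = local_point x0 n s r" by (simp add: local_point_tangent algebra_simps)
qed

lemma regular_closed_curve_has_param_deriv:
  assumes "regular_closed_curve g" "p \<in> {0..1}"
  shows "(g has_vector_derivative param_deriv g p) (at p within {0..1})"
  using assms unfolding regular_closed_curve_def param_deriv_def vector_derivative_works[symmetric] by blast

text \<open>
  The graph \<open>P\<close> is connected and the boundary curves are disjoint closed sets, so \<open>P\<close> lies on a single curve.
  On the set \<open>A\<close> of parameters with image in \<open>P\<close>, the tangential coordinate \<open>\<phi>\<close> is injective and its image is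
  \<open>(-L, L)\<close> up to one point, so that the one-dimensional change of variables applies as soon as the speed of the
  curve is known to be \<open>\<bar>\<phi>'\<bar> sqrt (1 + g\<^sup>2)\<close> on \<open>A\<close>.  All other parameters belong to points off the graph, where \<open>B\<close>
  bounds the integrand.
\<close>

lemma arc_length_integral_near_graph:
  fixes \<gamma> :: "nat \<Rightarrow> real \<Rightarrow> real^2" and Y g :: "real \<Rightarrow> real" and F :: "real^2 \<Rightarrow> real"
  assumes L: "0 < L" and n: "norm n = 1"
    and curves: "\<And>i. i < m \<Longrightarrow> regular_closed_curve (\<gamma> i)"
    and disj: "disjoint_family_on (\<lambda>i. path_image (\<gamma> i)) {..<m}"
    and cont_deriv: "\<And>i. i < m \<Longrightarrow> continuous_on {0..1} (param_deriv (\<gamma> i))"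
    and cont_F: "\<And>i. i < m \<Longrightarrow> continuous_on {0..1} (\<lambda>p. F (\<gamma> i p))"
    and Y: "\<And>s. s \<in> {-L<..<L} \<Longrightarrow> (Y has_real_derivative g s) (at s)"
    and P: "P = (\<lambda>s. local_point x0 n s (Y s)) ` {-L<..<L}"
    and P_sub: "P \<subseteq> (\<Union>i<m. path_image (\<gamma> i))"
    and far: "\<And>q. q \<in> (\<Union>i<m. path_image (\<gamma> i)) - P \<Longrightarrow> \<bar>F q\<bar> \<le> B" and B: "0 \<le> B"
    and V: "\<And>i p. i < m \<Longrightarrow> p \<in> {0..1} \<Longrightarrow> norm (param_deriv (\<gamma> i) p) \<le> V"
  defines "h \<equiv> \<lambda>s. F (local_point x0 n s (Y s)) * sqrt (1 + (g s)\<^sup>2)"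
  shows "h integrable_on {-L<..<L}"
    and "\<bar>arc_length_integral m \<gamma> F - integral {-L<..<L} h\<bar> \<le> m * (B * V)"
proof -
  define gr where "gr = (\<lambda>s. local_point x0 n s (Y s))"
  define X where "X = (\<lambda>q. (q - x0) \<bullet> tangent n)"
  define Z where "Z = (\<lambda>q. (q - x0) \<bullet> n)"
  have inP: "q \<in> P \<longleftrightarrow> X q \<in> {-L<..<L} \<and> Z q = Y (X q)" for q
    unfolding P image_iff local_point_eq_iff[OF n] X_def Z_def by auto
  have gr_X: "q = gr (X q)" if "q \<in> P" for q
    using that unfolding inP by (simp add: gr_def local_point_eq_iff[OF n] X_def Z_def)
  have X_gr: "X (gr s) = s" for s
    using local_point_eq_iff[OF n, of "gr s" x0 s "Y s"] by (simp add: gr_def X_def)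
  have contY: "continuous_on {-L<..<L} Y"
    using Y by (meson DERIV_isCont continuous_at_imp_continuous_on)
  have cont_gr: "continuous_on {-L<..<L} gr"
    unfolding gr_def local_point_tangent by (intro continuous_intros contY)
  have closed_image: "closed (path_image (\<gamma> i))" if "i < m" for i
    using curves[OF that] unfolding regular_closed_curve_def
    by (intro compact_imp_closed compact_path_image simple_path_imp_path) auto
  have "gr 0 \<in> P" using L by (auto simp: P gr_def)
  then obtain j where j: "j < m" "gr 0 \<in> path_image (\<gamma> j)" using P_sub by auto
  have P_j: "P \<subseteq> path_image (\<gamma> j)"
  proof -
    define R where "R = (\<Union>i\<in>{..<m} - {j}. path_image (\<gamma> i))"
    have "connected P" unfolding P using connected_continuous_image[OF cont_gr[unfolded gr_def]] by simp
    moreover have "closed R" unfolding R_def using closed_image by (intro closed_UN) auto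
    moreover have "path_image (\<gamma> j) \<inter> R \<inter> P = {}"
      using disj j unfolding disjoint_family_on_def R_def by blast
    moreover have "P \<subseteq> path_image (\<gamma> j) \<union> R" using P_sub unfolding R_def by blast
    ultimately have "path_image (\<gamma> j) \<inter> P = {} \<or> R \<inter> P = {}"
      by (intro connected_closedD closed_image j) auto
    then show ?thesis using \<open>gr 0 \<in> P\<close> j \<open>P \<subseteq> path_image (\<gamma> j) \<union> R\<close> by blast
  qed
  let ?c = "\<gamma> j"
  define \<phi> where "\<phi> = (\<lambda>p. X (?c p))"
  define \<phi>' where "\<phi>' = (\<lambda>p. param_deriv ?c p \<bullet> tangent n)"
  define A where "A = {p \<in> {0<..<1}. ?c p \<in> P}"
  have simple: "simple_path ?c" and closed_c: "pathfinish ?c = pathstart ?c"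
    using curves[OF j(1)] unfolding regular_closed_curve_def by auto
  have cont_c: "continuous_on {0..1} ?c" using simple_path_imp_path[OF simple] by (simp add: path_def)
  have inj_c: "p = q" if "?c p = ?c q" "p \<in> {0<..<1}" "q \<in> {0..1}" for p q
    using simple that unfolding simple_path_def loop_free_def by force
  have dc: "(?c has_vector_derivative param_deriv ?c p) (at p within A)" if "p \<in> A" for p
    using that by (intro has_vector_derivative_within_subset[OF regular_closed_curve_has_param_deriv[OF curves[OF j(1)]]])
      (auto simp: A_def)
  have d\<phi>: "(\<phi> has_field_derivative \<phi>' p) (at p within A)" if "p \<in> A" for p
    unfolding \<phi>_def \<phi>'_def X_def has_real_derivative_iff_has_vector_derivative
    using dc[OF that] by (auto intro!: derivative_eq_intros bounded_linear.has_vector_derivative[OF bounded_linear_inner_left])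
  \<comment> \<open>An isolated point of \<open>A\<close> would allow no comparison of derivatives. It is excluded as follows: if \<open>A\<close> had no
      other point near \<open>p\<close>, then \<open>P\<close> without the image of \<open>p\<close> would lie in the closed image \<open>K\<close> of the remaining
      parameters, hence so would the image of \<open>p\<close>, against injectivity of the curve.\<close>
  have islim: "p islimpt A" if p: "p \<in> A" for p
  proof (rule ccontr)
    assume "\<not> p islimpt A"
    then obtain \<epsilon> where \<epsilon>: "0 < \<epsilon>" "\<And>q. q \<in> A \<Longrightarrow> q \<noteq> p \<Longrightarrow> \<epsilon> \<le> dist q p"
      unfolding islimpt_approachable by (meson not_less)
    define K where "K = ?c ` ({0..1} - (ball p \<epsilon> \<inter> {0<..<1}))"
    have "compact ({0..1} - (ball p \<epsilon> \<inter> {0<..<1}))" by (intro compact_diff open_Int) auto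
    then have "closed K" unfolding K_def
      by (intro compact_imp_closed compact_continuous_image continuous_on_subset[OF cont_c]) auto
    let ?s = "X (?c p)"
    have s: "?s \<in> {-L<..<L}" "gr ?s = ?c p" using p inP gr_X[of "?c p"] by (auto simp: A_def)
    have "gr x \<in> K" if x: "x \<in> {-L<..<L}" "x \<noteq> ?s" for x
    proof -
      have "gr x \<in> P" using x by (auto simp: P gr_def)
      then obtain q where q: "q \<in> {0..1}" "gr x = ?c q" using P_j by (auto simp: path_image_def)
      have "q \<noteq> p" using q x X_gr[of x] by auto
      then have "q \<notin> ball p \<epsilon> \<inter> {0<..<1}" using \<epsilon>(2)[of q] q \<open>gr x \<in> P\<close> by (force simp: A_def dist_commute)
      then show ?thesis using q by (auto simp: K_def)
    qed
    then have "eventually (\<lambda>x. gr x \<in> K) (at ?s)"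
      using s unfolding eventually_at_topological by (intro exI[of _ "{-L<..<L}"]) auto
    moreover have "(gr \<longlongrightarrow> gr ?s) (at ?s)"
      unfolding isCont_def[symmetric] by (rule continuous_on_interior[OF cont_gr]) (use s in simp)
    ultimately have "gr ?s \<in> K" using \<open>closed K\<close> by (intro Lim_in_closed_set[of K gr "at ?s"]) auto
    then have "?c p \<in> K" using s by simp
    then obtain q where "q \<in> {0..1} - (ball p \<epsilon> \<inter> {0<..<1})" "?c p = ?c q"
      unfolding K_def by (rule imageE)
    moreover from this have "q = p" using inj_c[of p q] p by (auto simp: A_def)
    ultimately show False using \<epsilon>(1) p by (auto simp: A_def)
  qed
  \<comment> \<open>On \<open>A\<close> the normal coordinate of the curve is \<open>Y\<close> of its tangential coordinate, so the two derivatives are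
      proportional with factor \<open>g\<close>.\<close>
  have speed: "norm (param_deriv ?c p) = \<bar>\<phi>' p\<bar> * sqrt (1 + (g (\<phi> p))\<^sup>2)" if p: "p \<in> A" for p
  proof -
    define \<psi>' where "\<psi>' = param_deriv ?c p \<bullet> n"
    have \<phi>I: "\<phi> p \<in> {-L<..<L}" using p inP by (auto simp: A_def \<phi>_def)
    have "((\<lambda>p. Z (?c p)) has_vector_derivative \<psi>') (at p within A)"
      unfolding \<psi>'_def Z_def
      using dc[OF p] by (auto intro!: derivative_eq_intros bounded_linear.has_vector_derivative[OF bounded_linear_inner_left])
    then have "((\<lambda>p. Y (\<phi> p)) has_vector_derivative \<psi>') (at p within A)"
      by (rule has_vector_derivative_transform[OF p, rotated]) (auto simp: A_def inP \<phi>_def)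
    moreover have "((\<lambda>p. Y (\<phi> p)) has_vector_derivative g (\<phi> p) * \<phi>' p) (at p within A)"
      using DERIV_chain2[OF Y[OF \<phi>I] d\<phi>[OF p]] by (simp add: has_real_derivative_iff_has_vector_derivative)
    ultimately have "\<psi>' = g (\<phi> p) * \<phi>' p"
      using islim[OF p] by (intro vector_derivative_unique_within[of p A]) (auto simp: trivial_limit_within)
    moreover have "(norm (param_deriv ?c p))\<^sup>2 = (\<phi>' p)\<^sup>2 + \<psi>'\<^sup>2"
      using norm_frame[OF n, of "\<phi>' p" \<psi>'] frame_expansion[OF n, of "param_deriv ?c p"] by (simp add: \<phi>'_def \<psi>'_def)
    ultimately have "(norm (param_deriv ?c p))\<^sup>2 = (\<phi>' p)\<^sup>2 * (1 + (g (\<phi> p))\<^sup>2)"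
      by (simp add: power_mult_distrib algebra_simps)
    then have "norm (param_deriv ?c p) = sqrt ((\<phi>' p)\<^sup>2 * (1 + (g (\<phi> p))\<^sup>2))"
      by (metis norm_ge_zero real_sqrt_abs abs_of_nonneg)
    then show ?thesis by (simp add: real_sqrt_mult)
  qed
  have inj\<phi>: "inj_on \<phi> A"
  proof (rule inj_onI)
    fix p q assume "p \<in> A" "q \<in> A" "\<phi> p = \<phi> q"
    then have "?c p = ?c q" using gr_X[of "?c p"] gr_X[of "?c q"] by (simp add: A_def \<phi>_def)
    then show "p = q" using \<open>p \<in> A\<close> \<open>q \<in> A\<close> by (intro inj_c) (auto simp: A_def)
  qed
  have cont\<phi>: "continuous_on {0<..<1} \<phi>"
    unfolding \<phi>_def X_def by (intro continuous_intros continuous_on_subset[OF cont_c]) auto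
  \<comment> \<open>\<open>A\<close> is relatively closed in an open set, because it is cut out by the equation of the graph.\<close>
  have measA: "A \<in> sets lebesgue"
  proof -
    define O' where "O' = {0<..<1} \<inter> \<phi> -` {-L<..<L}"
    have O': "open O'" unfolding O'_def by (intro continuous_open_preimage cont\<phi>) auto
    have "continuous_on O' (\<lambda>p. Z (?c p) - Y (\<phi> p))"
      unfolding Z_def O'_def
      by (intro continuous_intros continuous_on_subset[OF cont_c] continuous_on_compose2[OF contY] continuous_on_subset[OF cont\<phi>]) auto
    then have "closedin (top_of_set O') {p \<in> O'. Z (?c p) - Y (\<phi> p) = 0}" by (rule continuous_closedin_preimage_constant)
    moreover have "{p \<in> O'. Z (?c p) - Y (\<phi> p) = 0} = A" by (auto simp: A_def O'_def inP \<phi>_def)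
    ultimately obtain T where "closed T" "A = O' \<inter> T" unfolding closedin_closed by auto
    then show ?thesis using O' by auto
  qed
  define G where "G = (\<lambda>i p. F (\<gamma> i p) * norm (param_deriv (\<gamma> i) p))"
  have contG: "continuous_on {0..1} (G i)" if "i < m" for i
    unfolding G_def by (intro continuous_intros cont_F cont_deriv that)
  have "G j absolutely_integrable_on A"
    by (rule set_integrable_subset[OF absolutely_integrable_continuous_real[OF contG[OF j(1)]]])
      (use measA in \<open>auto simp: A_def\<close>)
  moreover have pull: "\<bar>\<phi>' p\<bar> * h (\<phi> p) = G j p" if "p \<in> A" for p
    using gr_X[of "?c p"] that speed[OF that] by (simp add: A_def h_def G_def \<phi>_def gr_def)
  ultimately have "(\<lambda>p. \<bar>\<phi>' p\<bar> * h (\<phi> p)) absolutely_integrable_on A \<and> integral A (\<lambda>p. \<bar>\<phi>' p\<bar> * h (\<phi> p)) = integral A (G j)"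
    by (auto intro!: integral_cong cong: set_integrable_cong)
  then have h1: "h absolutely_integrable_on \<phi> ` A" "integral (\<phi> ` A) h = integral A (G j)"
    by (subst (asm) has_absolute_integral_change_of_variables_1'[OF measA d\<phi> inj\<phi>]; simp)+
  have sub: "\<phi> ` A \<subseteq> {-L<..<L}" using inP by (auto simp: A_def \<phi>_def)
  \<comment> \<open>Only the base point of the closed curve, excluded from the open parameter interval, can be missed.\<close>
  have "{-L<..<L} - \<phi> ` A \<subseteq> {\<phi> 0}"
  proof
    fix s assume s: "s \<in> {-L<..<L} - \<phi> ` A"
    then have "gr s \<in> P" by (auto simp: P gr_def)
    then obtain p where p: "p \<in> {0..1}" "gr s = ?c p" using P_j by (auto simp: path_image_def)
    have "\<phi> p = s" using p X_gr[of s] by (simp add: \<phi>_def)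
    then have "p \<notin> {0<..<1}" using s p \<open>gr s \<in> P\<close> by (auto simp: A_def)
    then have "p = 0 \<or> p = 1" using p by auto
    then have "?c p = ?c 0" using closed_c by (auto simp: pathfinish_def pathstart_def)
    then show "s \<in> {\<phi> 0}" using \<open>\<phi> p = s\<close> by (simp add: \<phi>_def)
  qed
  then have neg: "negligible ({-L<..<L} - \<phi> ` A)" by (rule negligible_subset[rotated]) simp
  show "h integrable_on {-L<..<L}"
  proof (rule integrable_spike_set[OF set_lebesgue_integral_eq_integral(1)[OF h1(1)]])
    have "{x \<in> \<phi> ` A - {-L<..<L}. h x \<noteq> 0} = {}" using sub by blast
    then show "negligible {x \<in> \<phi> ` A - {-L<..<L}. h x \<noteq> 0}" by (simp only: negligible_empty)
    show "negligible {x \<in> {-L<..<L} - \<phi> ` A. h x \<noteq> 0}" by (rule negligible_subset[OF neg]) auto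
  qed
  have int_h: "integral {-L<..<L} h = integral A (G j)"
    using integral_subset_negligible[OF sub neg, of h] h1(2) by simp
  have V0: "0 \<le> V" using V[OF j(1), of 0] norm_ge_zero order_trans by (metis atLeastAtMost_iff order_refl zero_le_one)
  have GB: "\<bar>G i p\<bar> \<le> B * V" if "i < m" "p \<in> {0..1}" "\<gamma> i p \<notin> P" for i p
  proof -
    have "\<bar>F (\<gamma> i p)\<bar> \<le> B"
    proof (rule far)
      have "\<gamma> i p \<in> path_image (\<gamma> i)" using that(2) by (auto simp: path_image_def)
      then show "\<gamma> i p \<in> (\<Union>i<m. path_image (\<gamma> i)) - P" using that by blast
    qed
    then have "\<bar>F (\<gamma> i p)\<bar> * norm (param_deriv (\<gamma> i) p) \<le> B * V" by (rule mult_mono[OF _ V[OF that(1,2)] B]) simp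
    then show ?thesis by (simp add: G_def abs_mult)
  qed
  have each: "\<bar>integral {0..1} (G i) - (if i = j then integral A (G j) else 0)\<bar> \<le> B * V" if i: "i < m" for i
  proof -
    define H where "H = (\<lambda>p. if i = j \<and> p \<in> A then G i p else 0)"
    have iG: "G i integrable_on {0<..<1}"
      using integrable_continuous_interval[OF contG[OF i]] integrable_on_open_interval_real by auto
    have iH: "H integrable_on {0<..<1}" "integral {0<..<1} H = (if i = j then integral A (G j) else 0)"
    proof -
      have "A \<subseteq> {0<..<1}" by (auto simp: A_def)
      show "H integrable_on {0<..<1}"
      proof (cases "i = j")
        case True
        have "G j integrable_on A" using set_lebesgue_integral_eq_integral(1)[OF \<open>G j absolutely_integrable_on A\<close>] .
        then show ?thesis using True \<open>A \<subseteq> _\<close> by (simp add: H_def integrable_restrict_Int inf.absorb1)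
      qed (simp add: H_def integrable_0)
      show "integral {0<..<1} H = (if i = j then integral A (G j) else 0)"
        using \<open>A \<subseteq> _\<close> by (auto simp: H_def integral_restrict_Int inf.absorb1)
    qed
    have "norm (integral {0<..<1} (\<lambda>p. G i p - H p)) \<le> integral {0<..<1} (\<lambda>p::real. B * V)"
    proof (rule integral_norm_bound_integral)
      show "(\<lambda>p. G i p - H p) integrable_on {0<..<1}" by (intro integrable_diff iG iH)
      show "(\<lambda>p::real. B * V) integrable_on {0<..<1}"
        using integrable_on_open_interval_real[of "\<lambda>p. B * V" 0 1] by auto
      fix p :: real assume p: "p \<in> {0<..<1}"
      show "norm (G i p - H p) \<le> B * V"
      proof (cases "i = j \<and> p \<in> A")
        case True
        then show ?thesis using B V0 by (simp add: H_def)
      next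
        case False
        have "\<gamma> i p \<notin> P"
        proof (cases "i = j")
          case True
          then show ?thesis using False p by (auto simp: A_def)
        next
          case neq: False
          have "\<gamma> i p \<in> path_image (\<gamma> i)" using p by (auto simp: path_image_def)
          then show ?thesis using neq disj i j(1) P_j unfolding disjoint_family_on_def by blast
        qed
        then show ?thesis using False GB[OF i, of p] p by (auto simp: H_def)
      qed
    qed
    also have "\<dots> = B * V" unfolding integral_open_interval_real[symmetric] by simp
    finally show ?thesis
      using iG iH by (simp add: integral_diff integral_open_interval_real)
  qed
  have "integral A (G j) = (\<Sum>i<m. if i = j then integral A (G j) else 0)" using j(1) by simp
  then have "arc_length_integral m \<gamma> F - integral {-L<..<L} h = (\<Sum>i<m. integral {0..1} (G i) - (if i = j then integral A (G j) else 0))"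
    unfolding int_h by (simp add: arc_length_integral_def G_def sum_subtractf)
  also have "\<bar>\<dots>\<bar> \<le> (\<Sum>i<m. B * V)" by (intro order_trans[OF sum_abs] sum_mono each) auto
  finally show "\<bar>arc_length_integral m \<gamma> F - integral {-L<..<L} h\<bar> \<le> m * (B * V)" by simp
qed

section \<open>The single layer potential\<close>

text \<open>
  Off the diagonal the kernel vanishes faster than any power of \<open>u\<close>; the first power suffices and follows from
  \<open>exp (- z) \<le> 2 / z\<^sup>2\<close>.
\<close>

lemma heat_kernel_far:
  assumes "0 < u" "0 < \<rho>" "\<rho> \<le> norm w"
  shows "\<bar>heat_kernel w u\<bar> \<le> 8 / (pi * \<rho> ^ 4) * u"
proof -
  define z where "z = \<rho>\<^sup>2 / (4 * u)"
  have z: "0 < z" using assms by (simp add: z_def)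
  have "z \<le> (norm w)\<^sup>2 / (4 * u)"
    unfolding z_def using assms by (intro divide_right_mono power_mono) auto
  then have "exp (- (norm w)\<^sup>2 / (4 * u)) \<le> exp (- z)" by simp
  also have "\<dots> \<le> 2 / z\<^sup>2"
  proof -
    have "z\<^sup>2 / 2 \<le> exp z" using exp_lower_Taylor_quadratic[of z] z by linarith
    then have "exp (- z) * (z\<^sup>2 / 2) \<le> exp (- z) * exp z" by (intro mult_left_mono) auto
    then show ?thesis using z by (simp add: exp_minus field_simps)
  qed
  also have "2 / z\<^sup>2 = 32 * u\<^sup>2 / \<rho> ^ 4"
    using assms by (simp add: z_def power_divide power_mult_distrib power_mult[symmetric])
  finally have "exp (- (norm w)\<^sup>2 / (4 * u)) \<le> 32 * u\<^sup>2 / \<rho> ^ 4" .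
  then have "1 / (4 * pi * u) * exp (- (norm w)\<^sup>2 / (4 * u)) \<le> 1 / (4 * pi * u) * (32 * u\<^sup>2 / \<rho> ^ 4)"
    using assms by (intro mult_left_mono) auto
  also have "\<dots> = 8 / (pi * \<rho> ^ 4) * u" using assms by (simp add: power2_eq_square)
  finally show ?thesis using assms by (simp add: heat_kernel_def)
qed

lemma heat_kernel_local_point:
  assumes "norm n = 1"
  shows "heat_kernel (x0 + h *\<^sub>R n - local_point x0 n s r) u
    = 1 / (4 * pi * u) * exp (- (s\<^sup>2 + (h - r)\<^sup>2) / (4 * u))"
proof -
  have "x0 + h *\<^sub>R n - local_point x0 n s r = (- s) *\<^sub>R tangent n + (h - r) *\<^sub>R n"
    by (simp add: local_point_tangent algebra_simps)
  then have "(norm (x0 + h *\<^sub>R n - local_point x0 n s r))\<^sup>2 = s\<^sup>2 + (h - r)\<^sup>2"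
    using norm_frame[OF assms, of "- s" "h - r"] by simp
  then show ?thesis by (simp add: heat_kernel_def)
qed

text \<open>
  Before the final time the kernel has no singularity, so the integrand is jointly continuous in time and
  parameter.
\<close>

lemma continuous_on_layer_in_time:
  assumes t: "t \<le> T"
    and \<gamma>: "\<And>i. i < m \<Longrightarrow> continuous_on ({0..1} \<times> {0..T}) (\<lambda>(p, \<tau>). \<gamma> i \<tau> p)"
    and \<gamma>': "\<And>i. i < m \<Longrightarrow> continuous_on ({0..1} \<times> {0..T}) (\<lambda>(p, \<tau>). param_deriv (\<gamma> i \<tau>) p)"
    and \<sigma>: "\<And>i. i < m \<Longrightarrow> continuous_on ({0..1} \<times> {0..T}) (\<lambda>(p, \<tau>). \<sigma> (\<gamma> i \<tau> p) \<tau>)"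
  shows "continuous_on {0..<t} (\<lambda>\<tau>. arc_length_integral m (\<lambda>i. \<gamma> i \<tau>)
           (\<lambda>q. heat_kernel (x - q) (t - \<tau>) * \<sigma> q \<tau>))"
proof -
  have swap: "continuous_on ({0..<t} \<times> cbox 0 1) (\<lambda>z. f (snd z) (fst z))"
    if "continuous_on ({0..1} \<times> {0..T}) (\<lambda>(p, \<tau>). f p \<tau>)" for f :: "real \<Rightarrow> real \<Rightarrow> 'z::topological_space"
    using continuous_on_compose2[OF that, of "{0..<t} \<times> cbox 0 1" "\<lambda>z. (snd z, fst z)"] t
    by (force intro!: continuous_intros simp: case_prod_unfold)
  have "continuous_on {0..<t} (\<lambda>\<tau>. integral (cbox 0 1) (\<lambda>p. heat_kernel (x - \<gamma> i \<tau> p) (t - \<tau>) * \<sigma> (\<gamma> i \<tau> p) \<tau>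
          * norm (param_deriv (\<gamma> i \<tau>) p)))" if i: "i < m" for i
  proof (rule integral_continuous_on_param)
    show "continuous_on ({0..<t} \<times> cbox 0 1) (\<lambda>(\<tau>, p). heat_kernel (x - \<gamma> i \<tau> p) (t - \<tau>) * \<sigma> (\<gamma> i \<tau> p) \<tau>
          * norm (param_deriv (\<gamma> i \<tau>) p))"
      unfolding case_prod_unfold heat_kernel_def
      by (intro continuous_intros swap[OF \<gamma>[OF i]] swap[OF \<gamma>'[OF i]] swap[OF \<sigma>[OF i]]) auto
  qed
  then show ?thesis unfolding arc_length_integral_def by (intro continuous_on_sum) simp
qed

lemma uniform_bound_on_compact:
  fixes f :: "nat \<Rightarrow> 'a::topological_space \<Rightarrow> 'b::real_normed_vector"
  assumes "compact K" "\<And>i. i < m \<Longrightarrow> continuous_on K (f i)"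
  obtains B where "0 \<le> B" "\<And>i z. i < m \<Longrightarrow> z \<in> K \<Longrightarrow> norm (f i z) \<le> B"
proof -
  have "\<exists>B. 0 \<le> B \<and> (\<forall>z\<in>K. norm (f i z) \<le> B)" if "i < m" for i
    using compact_imp_bounded[OF compact_continuous_image[OF assms(2)[OF that] assms(1)]]
    unfolding bounded_pos by (auto intro: less_imp_le)
  then obtain b where b: "\<And>i. i < m \<Longrightarrow> 0 \<le> b i" "\<And>i z. i < m \<Longrightarrow> z \<in> K \<Longrightarrow> norm (f i z) \<le> b i" by metis
  show ?thesis
  proof (rule that[of "\<Sum>i<m. b i"])
    show "0 \<le> (\<Sum>i<m. b i)" using b(1) by (intro sum_nonneg) auto
    show "norm (f i z) \<le> (\<Sum>i<m. b i)" if "i < m" "z \<in> K" for i z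
      using b(2)[OF that] member_le_sum[of i "{..<m}" b] b(1) that by force
  qed
qed

theorem lemma1:
  fixes \<Omega> :: "real \<Rightarrow> (real^2) set"
    and m :: nat and \<gamma> :: "nat \<Rightarrow> real \<Rightarrow> real \<Rightarrow> real^2"
    and \<sigma> :: "real^2 \<Rightarrow> real \<Rightarrow> real"
    and x0 n :: "real \<Rightarrow> real^2" and y :: "real \<Rightarrow> real \<Rightarrow> real \<Rightarrow> real"
    and T L \<delta> M c :: real
  assumes "T > 0" and "L > 0" and "\<delta> > 0"
    and "moving_domain T \<Omega> m \<gamma>"
    and "\<And>i. i < m \<Longrightarrow> continuous_on ({0..1} \<times> {0..T}) (\<lambda>(p, \<tau>). \<sigma> (\<gamma> i \<tau> p) \<tau>)"
    and "\<And>t. t \<in> {0<..T} \<Longrightarrow> x0 t \<in> moving_boundary m \<gamma> t"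
    and "\<And>t. t \<in> {0<..T} \<Longrightarrow> norm (n t) = 1"
    and "\<And>t. t \<in> {0<..T} \<Longrightarrow> eventually (\<lambda>r. x0 t + r *\<^sub>R n t \<in> \<Omega> t) (at_right 0)"
    and "\<And>t. t \<in> {0<..T} \<Longrightarrow> local_graph L \<delta> (moving_boundary m \<gamma>) t (x0 t) (n t) (y t)"
    and "\<And>t. t \<in> {0<..T} \<Longrightarrow>
           bounded_differentiable 4 M ({-L<..<L} \<times> {0..t}) (\<lambda>(s, \<tau>). y t s \<tau>)"
    and "\<And>t. t \<in> {0<..T} \<Longrightarrow>
           bounded_differentiable 4 M ({-L<..<L} \<times> {0..t})
             (\<lambda>(s, \<tau>). \<sigma> (local_point (x0 t) (n t) s (y t s \<tau>)) \<tau>)"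
  shows "(\<lambda>t. single_layer m \<gamma> \<sigma> (x0 t + (c * sqrt t) *\<^sub>R n t) t
            - 1 / 2 * sqrt (t / pi) * exp_integral (3 / 2) (c\<^sup>2 / 4)
              * (1 + (curvature_at t (y t) - normal_velocity_at t (y t)) / 2 * c * sqrt t)
              * \<sigma> (x0 t) t)
         \<in> O[at_right 0](\<lambda>t. t powr (3 / 2))"
proof -
  note T = assms(1) and L = assms(2) and \<delta> = assms(3) and domain = assms(4) and cont_\<sigma> = assms(5)
    and unit = assms(7) and graph = assms(9) and bd_y = assms(10) and bd_\<sigma> = assms(11)
  have cont_\<gamma>: "continuous_on ({0..1} \<times> {0..T}) (\<lambda>(p, \<tau>). \<gamma> i \<tau> p)"
    and cont_\<gamma>': "continuous_on ({0..1} \<times> {0..T}) (\<lambda>(p, \<tau>). param_deriv (\<gamma> i \<tau>) p)" if "i < m" for i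
    using domain that unfolding moving_domain_def by auto
  have M: "0 \<le> M"
    using bounded_differentiable_bound[OF bd_y[of T], of "(0, T)"] T L by auto
  obtain S where S: "0 \<le> S" "\<And>i z. i < m \<Longrightarrow> z \<in> {0..1} \<times> {0..T} \<Longrightarrow> norm (case z of (p, \<tau>) \<Rightarrow> \<sigma> (\<gamma> i \<tau> p) \<tau>) \<le> S"
    by (rule uniform_bound_on_compact[of "{0..1} \<times> {0..T}" m "\<lambda>i (p, \<tau>). \<sigma> (\<gamma> i \<tau> p) \<tau>"])
      (auto intro: compact_Times cont_\<sigma>)
  obtain V where V: "0 \<le> V" "\<And>i z. i < m \<Longrightarrow> z \<in> {0..1} \<times> {0..T} \<Longrightarrow> norm (case z of (p, \<tau>) \<Rightarrow> param_deriv (\<gamma> i \<tau>) p) \<le> V"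
    by (rule uniform_bound_on_compact[of "{0..1} \<times> {0..T}" m "\<lambda>i (p, \<tau>). param_deriv (\<gamma> i \<tau>) p"])
      (auto intro: compact_Times cont_\<gamma>')
  obtain C where C: "0 \<le> C" and near: "\<And>t u y g a a0 a1 \<kappa> v.
    \<lbrakk>0 < u; u \<le> t; t \<le> 1; 4 * \<bar>c\<bar> * (M * (3 + L)) * sqrt t \<le> 1;
     second_order_contact M L u \<kappa> v a0 a1 y g a;
     (\<lambda>s. exp (- (s\<^sup>2 + (c * sqrt t - y s)\<^sup>2) / (4 * u)) * (a s * sqrt (1 + (g s)\<^sup>2)))
       integrable_on {-L<..<L}\<rbrakk> \<Longrightarrow>
    \<bar>1 / (4 * pi * u) * integral {-L<..<L}
        (\<lambda>s. exp (- (s\<^sup>2 + (c * sqrt t - y s)\<^sup>2) / (4 * u)) * (a s * sqrt (1 + (g s)\<^sup>2)))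
      - exp (- (c * sqrt t)\<^sup>2 / (4 * u)) / sqrt (4 * pi * u) * (a0 * (1 + (\<kappa> - v) / 2 * (c * sqrt t)))\<bar>
    \<le> C * t / sqrt (4 * pi * u)"
    by (fact graph_potential_expansion[OF M L])
  define k where "k = 8 / (pi * (\<delta> / 2) ^ 4)"
  define C' where "C' = C + m * (k * S * V) * sqrt (4 * pi)"
  \<comment> \<open>The inequality \<open>K * sqrt t \<le> 1\<close> combines the smallness needed for the graph expansion with the requirement that
      the target is within \<open>\<delta> / 2\<close> of the boundary point.\<close>
  define K where "K = 1 + 4 * \<bar>c\<bar> * (M * (3 + L)) + 2 * \<bar>c\<bar> / \<delta>"
  define t0 where "t0 = min T (1 / K\<^sup>2)"
  have k0: "0 \<le> k" using \<delta> by (simp add: k_def)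
  have K1: "1 \<le> K" using M L \<delta> by (simp add: K_def)
  have t0: "0 < t0" using T K1 by (simp add: t0_def)
  have bound: "\<bar>single_layer m \<gamma> \<sigma> (x0 t + (c * sqrt t) *\<^sub>R n t) t
            - 1 / 2 * sqrt (t / pi) * exp_integral (3 / 2) (c\<^sup>2 / 4)
              * (1 + (curvature_at t (y t) - normal_velocity_at t (y t)) / 2 * c * sqrt t)
              * \<sigma> (x0 t) t\<bar> \<le> 1 / 2 * sqrt (t / pi) * exp_integral (3 / 2) 0 * (C' * t)"
    if t: "t \<in> {0<..<t0}" for t
  proof -
    have tT: "t \<in> {0<..T}" and tpos: "0 < t" using t by (auto simp: t0_def)
    have "sqrt t \<le> sqrt (1 / K\<^sup>2)" using t by (simp add: t0_def)
    then have sqrt_t: "K * sqrt t \<le> 1" using K1 by (simp add: real_sqrt_divide field_simps)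
    have t1: "t \<le> 1"
    proof -
      have "sqrt t \<le> K * sqrt t" using K1 tpos by simp
      then have "sqrt t \<le> 1" using sqrt_t by linarith
      then show ?thesis by simp
    qed
    have K_split: "K * sqrt t = sqrt t + 4 * \<bar>c\<bar> * (M * (3 + L)) * sqrt t + 2 * \<bar>c\<bar> / \<delta> * sqrt t"
      by (simp add: K_def distrib_right)
    have nonneg: "0 \<le> sqrt t" "0 \<le> 4 * \<bar>c\<bar> * (M * (3 + L)) * sqrt t" "0 \<le> 2 * \<bar>c\<bar> / \<delta> * sqrt t"
      using M L \<delta> tpos by simp_all
    have small: "4 * \<bar>c\<bar> * (M * (3 + L)) * sqrt t \<le> 1" using sqrt_t nonneg K_split by linarith
    have "2 * \<bar>c\<bar> / \<delta> * sqrt t \<le> 1" using sqrt_t nonneg K_split by linarith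
    then have c_small: "\<bar>c\<bar> * sqrt t \<le> \<delta> / 2" using \<delta> by (simp add: field_simps)
    let ?x = "x0 t + (c * sqrt t) *\<^sub>R n t"
    define a where "a = (\<lambda>s \<tau>. \<sigma> (local_point (x0 t) (n t) s (y t s \<tau>)) \<tau>)"
    have y0: "y t 0 t = 0" "deriv (\<lambda>s. y t s t) 0 = 0" using graph[OF tT] by (auto simp: local_graph_def)
    have a0: "a 0 t = \<sigma> (x0 t) t" by (simp add: a_def y0 local_point_tangent)
    obtain g a1 where
      g: "\<And>s \<tau>. s \<in> {-L<..<L} \<Longrightarrow> \<tau> \<in> {0..t} \<Longrightarrow> ((\<lambda>x. y t x \<tau>) has_real_derivative g s \<tau>) (at s)"
      and contact: "\<And>\<tau>. \<tau> \<in> {0..t} \<Longrightarrow>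
        second_order_contact M L (t - \<tau>) (curvature_at t (y t)) (normal_velocity_at t (y t)) (a 0 t) a1
          (\<lambda>s. y t s \<tau>) (\<lambda>s. g s \<tau>) (\<lambda>s. a s \<tau>)"
      by (rule second_order_contact_of_graph[OF tpos L bd_y[OF tT] bd_\<sigma>[OF tT, folded a_def] y0]) blast
    define W where "W = a 0 t * (1 + (curvature_at t (y t) - normal_velocity_at t (y t)) / 2 * (c * sqrt t))"
    define \<Phi> where "\<Phi> = (\<lambda>\<tau>. arc_length_integral m (\<lambda>i. \<gamma> i \<tau>) (\<lambda>q. heat_kernel (?x - q) (t - \<tau>) * \<sigma> q \<tau>))"
    have "\<bar>\<Phi> \<tau> - exp (- (c * sqrt t)\<^sup>2 / (4 * (t - \<tau>))) / sqrt (4 * pi * (t - \<tau>)) * W\<bar>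
        \<le> C' * t / sqrt (4 * pi * (t - \<tau>))" if \<tau>: "\<tau> \<in> {0..<t}" for \<tau>
    proof -
      define u where "u = t - \<tau>"
      have u: "0 < u" "u \<le> t" using \<tau> by (auto simp: u_def)
      have \<tau>t: "\<tau> \<in> {0..t}" and \<tau>T: "\<tau> \<in> {0..T}" using \<tau> tT by auto
      define P where "P = (\<lambda>s. local_point (x0 t) (n t) s (y t s \<tau>)) ` {-L<..<L}"
      have P: "P \<subseteq> (\<Union>i<m. path_image (\<gamma> i \<tau>))"
        and P_far: "\<And>q. q \<in> (\<Union>i<m. path_image (\<gamma> i \<tau>)) - P \<Longrightarrow> \<delta> \<le> dist q (x0 t)"
        using graph[OF tT] \<tau>t unfolding local_graph_def moving_boundary_def P_def Let_def by blast+
      have slice: "continuous_on {0..1} (\<lambda>p. f p \<tau>)"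
        if "continuous_on ({0..1} \<times> {0..T}) (\<lambda>(p, \<tau>). f p \<tau>)" for f :: "real \<Rightarrow> real \<Rightarrow> 'z::topological_space"
        using continuous_on_compose2[OF that, of "{0..1}" "\<lambda>p. (p, \<tau>)"] \<tau>T by (force intro!: continuous_intros)
      define F where "F = (\<lambda>q. heat_kernel (?x - q) u * \<sigma> q \<tau>)"
      have cont_F: "continuous_on {0..1} (\<lambda>p. F (\<gamma> i \<tau> p))" if i: "i < m" for i
        unfolding F_def heat_kernel_def using u
        by (intro continuous_intros slice[OF cont_\<gamma>[OF i]] slice[OF cont_\<sigma>[OF i]]) auto
      have F_far: "\<bar>F q\<bar> \<le> k * u * S" if q: "q \<in> (\<Union>i<m. path_image (\<gamma> i \<tau>)) - P" for q
      proof -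
        obtain i p where "i < m" "p \<in> {0..1}" "q = \<gamma> i \<tau> p" using q by (auto simp: path_image_def)
        then have "\<bar>\<sigma> q \<tau>\<bar> \<le> S" using S(2)[of i "(p, \<tau>)"] \<tau>T by simp
        moreover have "\<bar>heat_kernel (?x - q) u\<bar> \<le> k * u"
          unfolding k_def
        proof (rule heat_kernel_far)
          have "norm ((c * sqrt t) *\<^sub>R n t) \<le> \<delta> / 2"
            using c_small tpos by (simp add: unit[OF tT] abs_mult)
          moreover have "norm (q - x0 t) \<le> norm (?x - q) + norm ((c * sqrt t) *\<^sub>R n t)"
            using norm_triangle_ineq4[of "(c * sqrt t) *\<^sub>R n t" "?x - q"] by (simp add: add.commute)
          ultimately show "\<delta> / 2 \<le> norm (?x - q)" using P_far[OF q] by (simp add: dist_norm)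
        qed (use u \<delta> in auto)
        ultimately show ?thesis unfolding F_def abs_mult using u k0 by (intro mult_mono) auto
      qed
      have split: "(\<lambda>s. F (local_point (x0 t) (n t) s (y t s \<tau>)) * sqrt (1 + (g s \<tau>)\<^sup>2)) integrable_on {-L<..<L}"
        "\<bar>\<Phi> \<tau> - integral {-L<..<L} (\<lambda>s. F (local_point (x0 t) (n t) s (y t s \<tau>)) * sqrt (1 + (g s \<tau>)\<^sup>2))\<bar>
          \<le> m * (k * u * S * V)"
      proof -
        have \<Phi>F: "\<Phi> \<tau> = arc_length_integral m (\<lambda>i. \<gamma> i \<tau>) F" by (simp add: \<Phi>_def F_def u_def)
        have curves: "regular_closed_curve (\<gamma> i \<tau>)" if "i < m" for i
          using domain \<tau>T that unfolding moving_domain_def by blast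
        have disj: "disjoint_family_on (\<lambda>i. path_image (\<gamma> i \<tau>)) {..<m}"
          using domain \<tau>T unfolding moving_domain_def by blast
        have B: "0 \<le> k * u * S" using k0 u S by simp
        have VV: "norm (param_deriv (\<gamma> i \<tau>) p) \<le> V" if "i < m" "p \<in> {0..1}" for i p
          using V(2)[OF that(1), of "(p, \<tau>)"] that \<tau>T by simp
        note near_graph = arc_length_integral_near_graph[where \<gamma> = "\<lambda>i. \<gamma> i \<tau>" and F = F,
            OF L unit[OF tT] curves disj slice[OF cont_\<gamma>'] cont_F g[OF _ \<tau>t] P_def P F_far B VV]
        show "(\<lambda>s. F (local_point (x0 t) (n t) s (y t s \<tau>)) * sqrt (1 + (g s \<tau>)\<^sup>2)) integrable_on {-L<..<L}"
          by (rule near_graph(1))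
        show "\<bar>\<Phi> \<tau> - integral {-L<..<L} (\<lambda>s. F (local_point (x0 t) (n t) s (y t s \<tau>)) * sqrt (1 + (g s \<tau>)\<^sup>2))\<bar>
          \<le> m * (k * u * S * V)"
          unfolding \<Phi>F by (rule near_graph(2))
      qed
      define f where "f = (\<lambda>s. exp (- (s\<^sup>2 + (c * sqrt t - y t s \<tau>)\<^sup>2) / (4 * u)) * (a s \<tau> * sqrt (1 + (g s \<tau>)\<^sup>2)))"
      have Ff: "(\<lambda>s. F (local_point (x0 t) (n t) s (y t s \<tau>)) * sqrt (1 + (g s \<tau>)\<^sup>2)) = (\<lambda>s. 1 / (4 * pi * u) * f s)"
        by (simp only: F_def heat_kernel_local_point[OF unit[OF tT]] f_def a_def mult.assoc)
      have "(\<lambda>s. (4 * pi * u) * (1 / (4 * pi * u) * f s)) integrable_on {-L<..<L}"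
        using split(1) unfolding Ff by (rule integrable_on_mult_right)
      then have "f integrable_on {-L<..<L}" using u by simp
      then have "\<bar>1 / (4 * pi * u) * integral {-L<..<L} f
          - exp (- (c * sqrt t)\<^sup>2 / (4 * u)) / sqrt (4 * pi * u) * W\<bar> \<le> C * t / sqrt (4 * pi * u)"
        unfolding f_def W_def by (rule near[OF u t1 small contact[OF \<tau>t, folded u_def]])
      moreover have "integral {-L<..<L} (\<lambda>s. 1 / (4 * pi * u) * f s) = 1 / (4 * pi * u) * integral {-L<..<L} f"
        by simp
      \<comment> \<open>The contribution of the rest of the boundary is \<open>O(u)\<close>, hence below the error \<open>t / sqrt u\<close> of the graph part.\<close>
      moreover have "m * (k * u * S * V) \<le> m * (k * S * V) * sqrt (4 * pi) * t / sqrt (4 * pi * u)"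
      proof -
        have "sqrt (4 * pi * u) \<le> sqrt (4 * pi)" using u t1 by simp
        then have "1 \<le> sqrt (4 * pi) / sqrt (4 * pi * u)" using u by simp
        then have "u * 1 \<le> t * (sqrt (4 * pi) / sqrt (4 * pi * u))" using u tpos by (intro mult_mono) auto
        then have "m * (k * S * V) * (u * 1) \<le> m * (k * S * V) * (t * (sqrt (4 * pi) / sqrt (4 * pi * u)))"
          using k0 S(1) V(1) by (intro mult_left_mono) auto
        then show ?thesis by (simp add: mult_ac)
      qed
      moreover have "C' * t / sqrt (4 * pi * u) = C * t / sqrt (4 * pi * u) + m * (k * S * V) * sqrt (4 * pi) * t / sqrt (4 * pi * u)"
        by (simp add: C'_def distrib_right add_divide_distrib)
      ultimately show ?thesis using split(2) unfolding Ff u_def[symmetric] by linarith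
    qed
    moreover have "continuous_on {0..<t} \<Phi>"
      unfolding \<Phi>_def by (rule continuous_on_layer_in_time[OF _ cont_\<gamma> cont_\<gamma>' cont_\<sigma>]) (use tT in auto)
    ultimately have "\<bar>integral {0..t} \<Phi> - 1 / 2 * sqrt (t / pi) * exp_integral (3 / 2) (c\<^sup>2 / 4) * W\<bar>
      \<le> 1 / 2 * sqrt (t / pi) * exp_integral (3 / 2) 0 * (C' * t)"
      by (intro time_integral_estimate[OF tpos])
    moreover have "single_layer m \<gamma> \<sigma> ?x t = integral {0..t} \<Phi>" by (simp add: single_layer_def \<Phi>_def)
    ultimately show ?thesis by (simp add: W_def a0 mult_ac)
  qed
  show ?thesis
  proof (rule bigoI)
    have "eventually (\<lambda>t. t \<in> {0<..<t0}) (at_right 0)" by (rule eventually_at_right_real[OF t0])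
    then show "eventually (\<lambda>t. norm (single_layer m \<gamma> \<sigma> (x0 t + (c * sqrt t) *\<^sub>R n t) t
            - 1 / 2 * sqrt (t / pi) * exp_integral (3 / 2) (c\<^sup>2 / 4)
              * (1 + (curvature_at t (y t) - normal_velocity_at t (y t)) / 2 * c * sqrt t)
              * \<sigma> (x0 t) t) \<le> (1 / 2 * exp_integral (3 / 2) 0 * C' / sqrt pi) * norm (t powr (3 / 2))) (at_right 0)"
    proof eventually_elim
      case (elim t)
      then have tpos: "0 < t" by simp
      have "t powr (3 / 2) = t powr (1 + 1 / 2)" by simp
      also have "\<dots> = t * sqrt t" using tpos by (subst powr_add) (simp add: powr_half_sqrt)
      finally have "norm (t powr (3 / 2)) = t * sqrt t" using tpos by simp
      then have "1 / 2 * sqrt (t / pi) * exp_integral (3 / 2) 0 * (C' * t)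
          = (1 / 2 * exp_integral (3 / 2) 0 * C' / sqrt pi) * norm (t powr (3 / 2))"
        by (simp only: real_sqrt_divide) simp
      then show ?case using bound[OF elim] by (simp only: real_norm_def)
    qed
  qed
qed

end
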